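(* Let $G^{a_1}D^{a_2}G^{a_3}D^{a_4}\cdots$ (with positive integers $a_i$) be the directive sequence of a standard Sturmian sequence $\mathbf u$ and let $\mathbf v$ be a complementary symmetric Rote sequence associated with $\mathbf u$, i.e. $\mathcal S(\mathbf v)=\mathbf u$. Then $\mathrm{cr}(\mathbf v)<\tfrac72$ if and only if the sequence $a_1a_2a_3\cdots$ is a concatenation of (finitely or infinitely many) blocks from the following list: $L_0$: $111$; $L_1$: $s1$, where $s\in\{2,4\}$; $L_2$: $c\,s\,31$, where $c\in\{1,3\}$ and $s\in\{2,4\}^*$ (a finite, possibly empty, word over $\{2,4\}$); $L_3$: $c\,\mathbf s$, where $c\in\{1,3\}$ and $\mathbf s\in\{2,4\}^{\mathbb N}$ (an infinite block), where, if the block $L_0$ appears in the concatenation $a_1a_2a_3\cdots$, then it is a prefix of $a_1a_2a_3\cdots$ (i.e. $L_0$ may be used only as the first block).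
   Context: $\mathbb N=\{0,1,2,\dots\}$. Sequences are right-infinite words; $\mathcal L(\mathbf u)$ is the set of finite factors of $\mathbf u$. A word $z$ equals $u^e$ (with $u$ non-empty, $e=|z|/|u|$) if $z$ is a prefix of $u^\omega=uuu\cdots$. For a non-empty factor $u$ of $\mathbf u$, $\mathrm{ind}_{\mathbf u}(u)=\sup\{e\in\mathbb Q:u^e\in\mathcal L(\mathbf u)\}$, and $\mathrm{cr}(\mathbf u)=\sup\{\mathrm{ind}_{\mathbf u}(u):u\text{ a non-empty factor of }\mathbf u\}$ (possibly $+\infty$). A Rote sequence is a binary sequence having exactly $2n$ factors of length $n$ for every $n\ge1$. It is complementary symmetric (CS) if its language is closed under the exchange of letters $0\leftrightarrow1$. For a binary sequence $\mathbf v=v_0v_1\cdots$, $\mathcal S(\mathbf v)=u_0u_1\cdots$ with $u_i=v_i+v_{i+1}\bmod2$. A Sturmian sequence (over $\{0,1\}$) has exactly $n+1$ factors of length $n$ for every $n\in\mathbb N$; it is standard if both $0\mathbf u$ and $1\mathbf u$ are Sturmian. Known facts: $\mathbf v$ is CS Rote iff $\mathcal S(\mathbf v)$ is Sturmian; for each Sturmian $\mathbf u$ there are exactly two CS Rote sequences with $\mathcal S(\mathbf v)=\mathbf u$, obtained from each other by exchanging letters, and they have the same language. Directive sequence: let $G:0\mapsto10,\ 1\mapsto1$ and $D:0\mapsto0,\ 1\mapsto01$. For every standard Sturmian $\mathbf u$ there is a unique sequence $\Delta_0\Delta_1\Delta_2\cdots\in\{G,D\}^{\mathbb N}$ (the directive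 sequence of $\mathbf u$) for which there are standard Sturmian sequences $\mathbf u^{(n)}$ with $\mathbf u=\Delta_0\Delta_1\cdots\Delta_{n-1}(\mathbf u^{(n)})$ for all $n\in\mathbb N$. *)

theory Defs
  imports "HOL-Library.Omega_Words_Fun" "HOL-Library.Z2" "HOL-Library.Extended_Real"
begin

section \<open>Factors, powers and the critical exponent\<close>

definition language :: "'a word \<Rightarrow> 'a list set" where
  "language w = {w [i \<rightarrow> j] | i j. True}"

definition complexity :: "'a word \<Rightarrow> nat \<Rightarrow> nat" where
  "complexity w n = card {x \<in> language w. length x = n}"

definition is_power :: "'a list \<Rightarrow> 'a list \<Rightarrow> rat \<Rightarrow> bool" where
  "is_power z x e \<longleftrightarrow> x \<noteq> [] \<and> e = of_nat (length z) / of_nat (length x) \<and>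
     z = prefix (length z) (x\<^sup>\<omega>)"

definition index :: "'a word \<Rightarrow> 'a list \<Rightarrow> ereal" where
  "index w x = (SUP e \<in> {e. \<exists>z \<in> language w. is_power z x e}. ereal (of_rat e))"

definition critical_exponent :: "'a word \<Rightarrow> ereal" where
  "critical_exponent w = (SUP x \<in> {x \<in> language w. x \<noteq> []}. index w x)"


section \<open>Sturmian and Rote sequences\<close>

definition sturmian :: "bit word \<Rightarrow> bool" where
  "sturmian u \<longleftrightarrow> (\<forall>n. complexity u n = n + 1)"

definition standard_sturmian :: "bit word \<Rightarrow> bool" where
  "standard_sturmian u \<longleftrightarrow> sturmian u \<and> sturmian (0 ## u) \<and> sturmian (1 ## u)"

definition rote :: "bit word \<Rightarrow> bool" where
  "rote v \<longleftrightarrow> (\<forall>n\<ge>1. complexity v n = 2 * n)"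

text \<open>On \<^typ>\<open>bit\<close>, addition is addition modulo 2, so \<open>b + 1\<close> is the other letter.\<close>

definition cs_rote :: "bit word \<Rightarrow> bool" where
  "cs_rote v \<longleftrightarrow> rote v \<and> (\<forall>x \<in> language v. map (\<lambda>b. b + 1) x \<in> language v)"

definition sum_word :: "bit word \<Rightarrow> bit word" where
  "sum_word v = (\<lambda>i. v i + v (Suc i))"


section \<open>Infinite concatenations and morphisms\<close>

text \<open>
  The infinite word \<open>B 0 @ B 1 @ B 2 @ \<dots>\<close>. Only meaningful if all \<open>B k\<close> are non-empty: then
  \<open>B 0 @ \<dots> @ B n\<close> has length greater than \<open>n\<close> and so determines the letter at position \<open>n\<close>.
\<close>

definition concat_word :: "(nat \<Rightarrow> 'a list) \<Rightarrow> 'a word" where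
  "concat_word B = (\<lambda>n. concat (map B [0..<Suc n]) ! n)"

lemma length_concat_ge:
  assumes "\<And>k. B k \<noteq> []"
  shows "n \<le> length (concat (map B [0..<n]))"
proof (induction n)
  case (Suc n)
  then show ?case using assms[of n] by (cases "B n") auto
qed simp

lemma concat_word_unfold:
  assumes ne: "\<And>k. B k \<noteq> []"
  shows "concat_word B = B 0 \<frown> concat_word (\<lambda>k. B (Suc k))"
proof
  fix n
  have split: "concat (map B [0..<Suc m]) = B 0 @ concat (map (\<lambda>k. B (Suc k)) [0..<m])" for m
    by (simp add: upt_conv_Cons map_Suc_upt [symmetric] comp_def del: upt_Suc)
  show "concat_word B n = (B 0 \<frown> concat_word (\<lambda>k. B (Suc k))) n"
  proof (cases "n < length (B 0)")
    case True
    then show ?thesis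
      by (simp add: concat_word_def split nth_append del: upt_Suc)
  next
    case False
    define m where "m = n - length (B 0)"
    let ?C = "\<lambda>k. B (Suc k)"
    have mn: "Suc m \<le> n" using False ne[of 0] by (cases "B 0") (auto simp: m_def)
    have "[0..<n] = [0..<Suc m] @ [Suc m..<n]"
      using mn by (metis le_add_diff_inverse upt_add_eq_append zero_le)
    moreover have "m < length (concat (map ?C [0..<Suc m]))"
      using length_concat_ge[of ?C "Suc m"] ne by (simp del: upt_Suc)
    ultimately have "concat (map ?C [0..<n]) ! m = concat (map ?C [0..<Suc m]) ! m"
      by (simp add: nth_append del: upt_Suc)
    then show ?thesis using False
      by (simp add: concat_word_def split nth_append m_def del: upt_Suc)
  qed
qed

definition morph_G :: "bit \<Rightarrow> bit list" where
  "morph_G b = (if b = 0 then [1, 0] else [1])"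

definition morph_D :: "bit \<Rightarrow> bit list" where
  "morph_D b = (if b = 0 then [0] else [0, 1])"

definition apply_morph :: "('a \<Rightarrow> 'b list) \<Rightarrow> 'a word \<Rightarrow> 'b word" where
  "apply_morph \<phi> w = concat_word (\<lambda>i. \<phi> (w i))"

text \<open>\<open>apply_morphs \<Delta> n w\<close> is \<open>\<Delta> 0 (\<Delta> 1 (\<dots> (\<Delta> (n - 1) w)))\<close>.\<close>

definition apply_morphs :: "(bit \<Rightarrow> bit list) word \<Rightarrow> nat \<Rightarrow> bit word \<Rightarrow> bit word" where
  "apply_morphs \<Delta> n w = foldr apply_morph (prefix n \<Delta>) w"

definition directive_sequence :: "bit word \<Rightarrow> (bit \<Rightarrow> bit list) word \<Rightarrow> bool" where
  "directive_sequence u \<Delta> \<longleftrightarrow> range \<Delta> \<subseteq> {morph_G, morph_D} \<and>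
     (\<exists>U. \<forall>n. standard_sturmian (U n) \<and> u = apply_morphs \<Delta> n (U n))"

text \<open>
  The word \<open>G\<^sup>a\<^sup>1 D\<^sup>a\<^sup>2 G\<^sup>a\<^sup>3 D\<^sup>a\<^sup>4 \<dots>\<close>. The exponents are indexed from 0 here, so those
  of \<open>G\<close> have even index.
\<close>

definition alternating_runs :: "nat word \<Rightarrow> (bit \<Rightarrow> bit list) word" where
  "alternating_runs a = concat_word (\<lambda>k. replicate (a k) (if even k then morph_G else morph_D))"


section \<open>Block decompositions\<close>

definition L0 :: "nat list set" where
  "L0 = {[1, 1, 1]}"

definition L1 :: "nat list set" where
  "L1 = {[s, 1] | s. s \<in> {2, 4}}"

definition L2 :: "nat list set" where
  "L2 = {[c] @ s @ [3, 1] | c s. c \<in> {1, 3} \<and> set s \<subseteq> {2, 4}}"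

definition L3 :: "nat word set" where
  "L3 = {c ## s | c s. c \<in> {1, 3} \<and> range s \<subseteq> {2, 4}}"

text \<open>
  An infinite word is a concatenation either of infinitely many finite blocks, or of finitely
  many blocks of which exactly the last one is infinite.
\<close>

definition block_concatenation :: "nat word \<Rightarrow> bool" where
  "block_concatenation a \<longleftrightarrow>
     (\<exists>B. (\<forall>i. B i \<in> L0 \<union> L1 \<union> L2) \<and> (\<forall>i. B i \<in> L0 \<longrightarrow> i = 0) \<and> a = concat_word B) \<or>
     (\<exists>Bs t. set Bs \<subseteq> L0 \<union> L1 \<union> L2 \<and> (\<forall>i < length Bs. Bs ! i \<in> L0 \<longrightarrow> i = 0) \<and>
        t \<in> L3 \<and> a = concat Bs \<frown> t)"

end

theory Submission
  imports Defs
begin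

text \<open>
  A repetition in \<open>v\<close> of period \<open>p\<close> and length \<open>p + l + 1\<close> is the same as a repetition in
  \<open>u = S(v)\<close> of period \<open>p\<close> and length \<open>p + l\<close> whose root contains an even number of ones. Repetitions
  of \<open>u\<close> are desubstituted along the directive sequence until their overlap \<open>l\<close> vanishes; substituting
  back, a repetition with root \<open>r\<close> and vanishing overlap at level \<open>k\<close> has overlap
  \<open>\<bar>A\<bar> + \<bar>B\<bar> - 2\<close> in \<open>u\<close>, where \<open>A\<close> and \<open>B\<close> are the images of the two letters at level \<open>k\<close>. So
  only powers of \<open>A\<close> and \<open>B\<close> can have exponent \<open>7/2\<close> or more in \<open>v\<close>, and only if they are the
  standard words \<open>s\<^sub>n = s\<^bsub>n-1\<^esub>\<^bsup>a\<^esup> s\<^bsub>n-2\<^esub>\<close>. This turns \<open>cr(v) < 7/2\<close> into a condition for each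
  \<open>n\<close> on the parities of the numbers of ones in \<open>s\<^sub>n\<close>, \<open>s\<^bsub>n-1\<^esub>\<close> and on the last few exponents
  \<open>a\<^sub>i\<close>: if \<open>s\<^sub>n\<close> has an odd number of ones, the next exponent is at most 4; if it has an even number,
  the next exponent is 1 and the previous one is at least 2, except for the prefix 111. Following the
  parities as states of an automaton gives the blocks, which begin exactly where \<open>s\<^bsub>n-1\<^esub>\<close> is even
  and \<open>s\<^sub>n\<close> is odd.
\<close>


subsection \<open>Infinite concatenations\<close>

definition offset :: "(nat \<Rightarrow> 'a list) \<Rightarrow> nat \<Rightarrow> nat" where
  "offset B i = length (concat (map B [0..<i]))"

lemma offset_0 [simp]: "offset B 0 = 0"
  by (simp add: offset_def)

lemma offset_Suc [simp]: "offset B (Suc i) = offset B i + length (B i)"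
  by (simp add: offset_def)

lemma concat_word_nth:
  assumes ne: "\<And>k. B k \<noteq> []" and n: "n < offset B m"
  shows "concat_word B n = concat (map B [0..<m]) ! n"
proof -
  have ext: "concat (map B [0..<i]) ! n = concat (map B [0..<j]) ! n"
    if "i \<le> j" "n < offset B i" for i j
  proof -
    have "[0..<j] = [0..<i] @ [i..<j]"
      using that(1) by (metis le_add_diff_inverse upt_add_eq_append zero_le)
    then show ?thesis using that(2) by (simp add: nth_append offset_def)
  qed
  have "n < offset B (Suc n)"
    unfolding offset_def using length_concat_ge[of B "Suc n"] ne by (metis Suc_le_lessD)
  then show ?thesis
    unfolding concat_word_def using ext[of "Suc n" m] ext[of m "Suc n"] n by (metis nat_le_linear)
qed

lemma concat_word_segment:
  assumes ne: "\<And>k. B k \<noteq> []" and "i \<le> j"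
  shows "(concat_word B) [offset B i \<rightarrow> offset B j] = concat (map B [i..<j])"
proof -
  have "[0..<j] = [0..<i] @ [i..<j]"
    using \<open>i \<le> j\<close> by (metis le_add_diff_inverse upt_add_eq_append zero_le)
  then have split: "concat (map B [0..<j]) = concat (map B [0..<i]) @ concat (map B [i..<j])"
    by simp
  then have len: "offset B j = offset B i + length (concat (map B [i..<j]))"
    by (simp add: offset_def)
  show ?thesis
  proof (rule nth_equalityI)
    show "length (concat_word B [offset B i \<rightarrow> offset B j]) = length (concat (map B [i..<j]))"
      using len by simp
  next
    fix k assume "k < length (concat_word B [offset B i \<rightarrow> offset B j])"
    then have k: "k < length (concat (map B [i..<j]))" using len by simp
    have "concat_word B (offset B i + k) = concat (map B [0..<j]) ! (offset B i + k)"
      using concat_word_nth[of B "offset B i + k" j, OF ne] k len by simp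
    also have "\<dots> = concat (map B [i..<j]) ! k"
      unfolding split by (simp add: nth_append offset_def)
    finally show "concat_word B [offset B i \<rightarrow> offset B j] ! k = concat (map B [i..<j]) ! k"
      using k len by simp
  qed
qed

lemma concat_word_at:
  assumes ne: "\<And>k. B k \<noteq> []" and "k < length (B i)"
  shows "concat_word B (offset B i + k) = B i ! k"
proof -
  have "(concat_word B) [offset B i \<rightarrow> offset B (Suc i)] ! k = B i ! k"
    using concat_word_segment[of B i "Suc i", OF ne] by simp
  then show ?thesis using assms(2) by simp
qed

lemma offset_cases:
  assumes ne: "\<And>k. B k \<noteq> []"
  obtains i k where "n = offset B i + k" "k < length (B i)"
proof -
  have "\<exists>i k. n = offset B i + k \<and> k < length (B i)"
  proof (induction n)
    case 0
    then show ?case using ne[of 0] by (intro exI[of _ 0]) simp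
  next
    case (Suc n)
    then obtain i k where ik: "n = offset B i + k" "k < length (B i)" by blast
    show ?case
    proof (cases "Suc k < length (B i)")
      case True
      then show ?thesis using ik by (intro exI[of _ i] exI[of _ "Suc k"]) simp
    next
      case False
      then show ?thesis using ik ne[of "Suc i"]
        by (intro exI[of _ "Suc i"] exI[of _ 0]) auto
    qed
  qed
  then show thesis using that by blast
qed

lemma concat_word_eqI:
  assumes "t 0 = 0" and "\<And>i. t i < t (Suc i)"
  shows "concat_word (\<lambda>i. (w [t i \<rightarrow> t (Suc i)])) = w"
proof
  fix n
  let ?B = "\<lambda>i. (w [t i \<rightarrow> t (Suc i)])"
  have ne: "?B k \<noteq> []" for k using assms(2)[of k] by simp
  have off: "offset ?B i = t i" for i
    using assms by (induction i) (auto simp: less_imp_le)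
  obtain i k where ik: "n = offset ?B i + k" "k < length (?B i)"
    using offset_cases[of ?B n] ne by blast
  then have "concat_word ?B n = ?B i ! k"
    using concat_word_at[of ?B k i] ne by blast
  also have "\<dots> = w n" using ik off by simp
  finally show "concat_word ?B n = w n" .
qed


subsection \<open>Repetitions and the two elementary morphisms\<close>

text \<open>One formula for \<open>G\<close> and \<open>D\<close>, with the leading letter as
  parameter, so that each argument is given once.\<close>

definition elem :: "bit \<Rightarrow> bit \<Rightarrow> bit list" where
  "elem b x = (if x = b then [b] else [b, x])"

lemma elem_not_Nil [simp]: "elem b x \<noteq> []"
  by (simp add: elem_def)

lemma morph_G_eq: "morph_G = elem 1" and morph_D_eq: "morph_D = elem 0"
  by (auto simp: fun_eq_iff morph_G_def morph_D_def elem_def)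

abbreviation image_pos :: "bit \<Rightarrow> bit word \<Rightarrow> nat \<Rightarrow> nat" where
  "image_pos b w \<equiv> offset (\<lambda>i. elem b (w i))"

lemma image_pos_Suc: "image_pos b w (Suc i) = image_pos b w i + (if w i = b then 1 else 2)"
  by (simp add: elem_def)

lemma image_at: "apply_morph (elem b) w (image_pos b w i) = b"
  using concat_word_at[of "\<lambda>i. elem b (w i)" 0 i] by (simp add: apply_morph_def elem_def)

text \<open>Both branches equal \<open>w i\<close>: the letter after the start of an image is the
  preimage letter itself, because a one-letter image is followed by the \<open>b\<close> that begins
  the next image. Decoding rests on this.\<close>

lemma image_at_Suc:
  "apply_morph (elem b) w (Suc (image_pos b w i)) = (if w i = b then b else w i)"
proof (cases "w i = b")
  case True
  then show ?thesis using image_at[of b w "Suc i"] by (simp add: elem_def)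
next
  case False
  then show ?thesis
    using concat_word_at[of "\<lambda>i. elem b (w i)" 1 i] by (simp add: apply_morph_def elem_def)
qed

lemma image_pos_cases:
  obtains i where "n = image_pos b w i"
  | i where "n = Suc (image_pos b w i)" "w i \<noteq> b"
proof -
  obtain i k where ik: "n = image_pos b w i + k" "k < length (elem b (w i))"
    using offset_cases[of "\<lambda>i. elem b (w i)" n] by auto
  show thesis
  proof (cases "k = 0")
    case True
    then show thesis using ik that(1) by simp
  next
    case False
    then have "k = 1" "w i \<noteq> b" using ik(2) by (simp_all add: elem_def split: if_splits)
    then show thesis using ik(1) that(2) by simp
  qed
qed

text \<open>Synchronisation: the second letter of a two-letter image differs from \<open>b\<close>,
  so every \<open>b\<close> marks the start of an image.\<close>

lemma image_pos_of_eq: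
  assumes "apply_morph (elem b) w n = b"
  obtains i where "n = image_pos b w i"
proof (rule image_pos_cases[of n b w])
  fix i assume "n = Suc (image_pos b w i)" "w i \<noteq> b"
  then show thesis using assms by (simp add: image_at_Suc)
qed (rule that)

lemma image_pos_of_neq:
  assumes "apply_morph (elem b) w n \<noteq> b"
  obtains i where "n = Suc (image_pos b w i)"
proof (rule image_pos_cases[of n b w])
  fix i assume "n = image_pos b w i"
  then show thesis using assms by (simp add: image_at)
qed (rule that)

lemma apply_morph_elem_inj:
  assumes "apply_morph (elem b) w = apply_morph (elem b) w'"
  shows "w = w'"
proof
  fix n
  have "image_pos b w n = image_pos b w' n \<and> w n = w' n"
  proof (induction n)
    case 0
    then show ?case
      using image_at_Suc[of b w 0] image_at_Suc[of b w' 0] assms by (auto split: if_splits)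
  next
    case (Suc n)
    then have eq: "image_pos b w (Suc n) = image_pos b w' (Suc n)" by simp
    then show ?case
      using image_at_Suc[of b w "Suc n"] image_at_Suc[of b w' "Suc n"] assms
      by (metis (full_types))
  qed
  then show "w n = w' n" ..
qed

text \<open>\<open>pull b f\<close> is the weight that \<open>f\<close> induces on letters through their images under \<open>elem b\<close>.\<close>

definition pull :: "bit \<Rightarrow> (bit \<Rightarrow> nat) \<Rightarrow> bit \<Rightarrow> nat" where
  "pull b f x = (if x = b then f b else f b + f x)"

lemma image_weight:
  assumes "i \<le> j"
  shows "sum_list (map f (apply_morph (elem b) w [image_pos b w i \<rightarrow> image_pos b w j])) =
    sum_list (map (pull b f) (w [i \<rightarrow> j]))"
proof -
  have "sum_list (map f (concat (map (elem b) xs))) = sum_list (map (pull b f) xs)" for xs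
    by (induction xs) (auto simp: elem_def pull_def)
  from this[of "w [i \<rightarrow> j]"] show ?thesis
    unfolding apply_morph_def using concat_word_segment[of "\<lambda>i. elem b (w i)" i j] assms
    by (simp add: subsequence_def comp_def)
qed

text \<open>
  The factor of length \<open>p + l\<close> at position \<open>i\<close> has period \<open>p\<close>. Counting the overlap \<open>l\<close> instead
  of the whole length makes the case \<open>l = 0\<close>, in which nothing is required, the end of desubstitution.
\<close>

definition repeats :: "'a word \<Rightarrow> nat \<Rightarrow> nat \<Rightarrow> nat \<Rightarrow> bool" where
  "repeats w i p l \<longleftrightarrow> (\<forall>k<l. w (i + k) = w (i + k + p))"

lemma sum_list_subsequence:
  "sum_list (map f (w [i \<rightarrow> i + n])) = (\<Sum>k<n. f (w (i + k)) :: nat)"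
proof (induction n)
  case (Suc n)
  have "w [i \<rightarrow> i + Suc n] = w [i \<rightarrow> i + n] @ [w (i + n)]" by (simp add: subsequence_def)
  then show ?case using Suc by simp
qed simp

lemma image_pos_less: "i < j \<Longrightarrow> image_pos b w i < image_pos b w j"
  by (rule lift_Suc_mono_less) (simp_all add: elem_def)

text \<open>Both occurrences are decoded in parallel. The overlap always ends at an image boundary
  or one letter beyond: at a boundary the next letter \<open>b\<close> reveals nothing, one letter
  later it reveals a common preimage letter.\<close>

lemma desubstitute_aligned:
  fixes w :: "bit word" and b :: bit
  defines "W \<equiv> apply_morph (elem b) w" and "h \<equiv> image_pos b w"
  assumes "repeats W (h i) p' l'" and "h j = h i + p'"
  shows "\<exists>l. (\<forall>k<l. w (i + k) = w (j + k)) \<and> h (j + l) = h (i + l) + p' \<and>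
    h (i + l) \<le> h i + l' \<and> h i + l' \<le> Suc (h (i + l))"
  using assms(3)
proof (induction l')
  case 0
  then show ?case using assms(4) by (intro exI[of _ 0]) simp
next
  case (Suc l')
  have "repeats W (h i) p' l'" using Suc.prems by (simp add: repeats_def)
  then obtain l where l: "\<forall>k<l. w (i + k) = w (j + k)" "h (j + l) = h (i + l) + p'"
    "h (i + l) \<le> h i + l'" "h i + l' \<le> Suc (h (i + l))"
    using Suc.IH by blast
  have eq: "W (h i + l') = W (h i + l' + p')" using Suc.prems by (simp add: repeats_def)
  show ?case
  proof (cases "h i + l' = h (i + l)")
    case True
    then show ?thesis using l by (intro exI[of _ l]) simp
  next
    case False
    then have t: "h i + l' = Suc (h (i + l))" using l by simp
    then have "h i + l' + p' = Suc (h (j + l))" using l by simp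
    then have "W (Suc (h (i + l))) = W (Suc (h (j + l)))" using eq t by simp
    then have "w (i + l) = w (j + l)"
      unfolding W_def h_def image_at_Suc by (metis (full_types))
    then have "\<forall>k<Suc l. w (i + k) = w (j + k)" using l(1) less_Suc_eq by auto
    moreover have "h (j + Suc l) = h (i + Suc l) + p'"
      using \<open>w (i + l) = w (j + l)\<close> l(2) by (simp add: h_def)
    moreover have "h (i + Suc l) \<le> h i + Suc l'" "h i + Suc l' \<le> Suc (h (i + Suc l))"
      using t unfolding h_def add_Suc_right image_pos_Suc by auto
    ultimately show ?thesis by blast
  qed
qed

text \<open>
  All images begin with \<open>b\<close>, so a repetition extends to the left until it begins with an image, and
  it may end with one letter \<open>b\<close> whose image is not yet determined: this is the summand \<open>f b\<close>.
\<close>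

lemma desubstitute_repeats:
  fixes w :: "bit word" and b :: bit
  defines "W \<equiv> apply_morph (elem b) w"
  assumes rep: "repeats W i' p' l'" and "0 < l'" and "0 < p'"
  obtains i p l where "repeats w i p l" and "0 < p"
    and "\<And>f :: bit \<Rightarrow> nat. sum_list (map f (W [i' \<rightarrow> i' + p'])) = sum_list (map (pull b f) (w [i \<rightarrow> i + p]))"
    and "\<And>f. sum_list (map f (W [i' \<rightarrow> i' + l'])) \<le> sum_list (map (pull b f) (w [i \<rightarrow> i + l])) + f b"
proof -
  define h where "h = image_pos b w"
  have aligned: "\<exists>i p l. repeats w i p l \<and> 0 < p \<and>
    (\<forall>f :: bit \<Rightarrow> nat. sum_list (map f (W [i' \<rightarrow> i' + p'])) = sum_list (map (pull b f) (w [i \<rightarrow> i + p]))) \<and>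
    (\<forall>f :: bit \<Rightarrow> nat. sum_list (map f (W [i' \<rightarrow> i' + l'])) \<le> sum_list (map (pull b f) (w [i \<rightarrow> i + l])) + f b)"
    if rep: "repeats W i' p' l'" and Wb: "W i' = b" and l': "0 < l'" for i' l'
  proof -
    have "W (i' + p') = b" using that by (auto simp: repeats_def)
    then obtain j where j: "i' + p' = h j"
      unfolding W_def h_def by (rule image_pos_of_eq)
    from Wb obtain i where "i' = h i"
      unfolding W_def h_def by (rule image_pos_of_eq)
    note ij = this j
    have "i < j"
    proof (rule ccontr)
      assume "\<not> i < j"
      then have "h j \<le> h i"
        using image_pos_less[of j i b w] unfolding h_def by (cases "i = j") auto
      then show False using ij \<open>0 < p'\<close> by simp
    qed
    define p where "p = j - i"
    have j: "j = i + p" using \<open>i < j\<close> p_def by simp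
    obtain l where l: "\<forall>k<l. w (i + k) = w (j + k)" "h (i + l) \<le> h i + l'"
      "h i + l' \<le> Suc (h (i + l))"
      using desubstitute_aligned[of b w i p' l' j] rep ij unfolding W_def h_def by auto
    have "repeats w i p l" using l(1) j by (simp add: repeats_def ac_simps)
    moreover have "0 < p" using \<open>i < j\<close> p_def by simp
    moreover have "sum_list (map f (W [i' \<rightarrow> i' + p'])) = sum_list (map (pull b f) (w [i \<rightarrow> i + p]))" for f
      using image_weight[of i j f b w] \<open>i < j\<close> ij j by (simp add: W_def h_def)
    moreover have "sum_list (map f (W [i' \<rightarrow> i' + l'])) \<le> sum_list (map (pull b f) (w [i \<rightarrow> i + l])) + f b" for f
    proof -
      have *: "sum_list (map f (W [h i \<rightarrow> h (i + l)])) = sum_list (map (pull b f) (w [i \<rightarrow> i + l]))"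
        using image_weight[of i "i + l" f b w] by (simp add: W_def h_def)
      have hi: "h i \<le> h (i + l)" using image_pos_less[of i "i + l" b w] unfolding h_def
        by (cases "l = 0") auto
      consider "i' + l' = h (i + l)" | "i' + l' = Suc (h (i + l))" using l ij by linarith
      then show ?thesis
      proof cases
        case 1
        then show ?thesis using * ij by simp
      next
        case 2
        then have "W [i' \<rightarrow> i' + l'] = W [h i \<rightarrow> h (i + l)] @ [W (h (i + l))]"
          using ij hi by (simp add: subsequence_def)
        then show ?thesis using * image_at[of b w "i + l"] by (simp add: W_def h_def)
      qed
    qed
    ultimately show ?thesis by blast
  qed
  show thesis
  proof (cases "W i' = b")
    case True
    then show ?thesis using aligned[OF rep] \<open>0 < l'\<close> that by metis
  next
    case False
    have eq: "W i' = W (i' + p')" using rep \<open>0 < l'\<close> by (auto simp: repeats_def)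
    from False obtain i where "i' = Suc (h i)"
      unfolding W_def h_def by (rule image_pos_of_neq)
    moreover have "W (i' + p') \<noteq> b" using False eq by simp
    then obtain j where "i' + p' = Suc (h j)"
      unfolding W_def h_def by (rule image_pos_of_neq)
    ultimately have ij: "i' = Suc (h i)" "i' + p' = Suc (h j)" .
    \<comment> \<open>Both occurrences begin at the second letter of an image and are preceded by
      \<open>b\<close>, so the repetition extends one letter to the left.\<close>
    define m where "m = h i"
    have m: "i' = Suc m" "m + p' = h j" using ij m_def by simp_all
    have Wm: "W m = b" "W (m + p') = b" using image_at[of b w] m by (simp_all add: W_def h_def m_def)
    have "W (m + k) = W (m + k + p')" if "k < Suc l'" for k
      using that rep m Wm unfolding repeats_def by (cases k) auto
    then have rep': "repeats W m p' (Suc l')" unfolding repeats_def by blast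
    \<comment> \<open>The root is only conjugated: the shifted window gains one \<open>b\<close> and
      loses another.\<close>
    have p: "sum_list (map f (W [i' \<rightarrow> i' + p'])) = sum_list (map f (W [m \<rightarrow> m + p']))" for f :: "bit \<Rightarrow> nat"
    proof -
      have "f (W m) + sum_list (map f (W [i' \<rightarrow> i' + p'])) =
          sum_list (map f (W [m \<rightarrow> m + p'])) + f (W (m + p'))"
        unfolding sum_list_subsequence m(1)
        using sum.lessThan_Suc_shift[of "\<lambda>k. f (W (m + k))" p']
          sum.lessThan_Suc[of "\<lambda>k. f (W (m + k))" p'] by simp
      then show ?thesis using Wm by simp
    qed
    have l: "sum_list (map f (W [i' \<rightarrow> i' + l'])) \<le> sum_list (map f (W [m \<rightarrow> m + Suc l']))" for f :: "bit \<Rightarrow> nat"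
      unfolding sum_list_subsequence m(1)
      using sum.lessThan_Suc_shift[of "\<lambda>k. f (W (m + k))" l'] by simp
    obtain i p l where *: "repeats w i p l" "0 < p"
      "\<And>f. sum_list (map f (W [m \<rightarrow> m + p'])) = sum_list (map (pull b f) (w [i \<rightarrow> i + p]))"
      "\<And>f. sum_list (map f (W [m \<rightarrow> m + Suc l'])) \<le> sum_list (map (pull b f) (w [i \<rightarrow> i + l])) + f b"
      using aligned[OF rep' Wm(1)] by auto
    show thesis
      by (rule that[of i p l]) (use * p le_trans[OF l *(4)] in auto)
  qed
qed

text \<open>Beyond the images of the overlap one more letter agrees, since the next image begins
  with \<open>b\<close> in both occurrences. Hence the summand \<open>f b\<close> of the
  desubstitution bound is attained.\<close>

lemma substitute_repeats:
  fixes w :: "bit word" and b :: bit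
  defines "W \<equiv> apply_morph (elem b) w"
  assumes rep: "repeats w i p l"
  obtains i' p' l' where "repeats W i' p' l'"
    and "\<And>f. sum_list (map f (W [i' \<rightarrow> i' + p'])) = sum_list (map (pull b f) (w [i \<rightarrow> i + p]))"
    and "\<And>f. sum_list (map f (W [i' \<rightarrow> i' + l'])) = sum_list (map (pull b f) (w [i \<rightarrow> i + l])) + f b"
proof -
  define h where "h = image_pos b w"
  have mono: "h x \<le> h y" if "x \<le> y" for x y
    using image_pos_less[of x y b w] that unfolding h_def by (cases "x = y") auto
  define p' where "p' = h (i + p) - h i"
  define l' where "l' = h (i + l) - h i"
  have p': "h (i + p) = h i + p'" and l': "h (i + l) = h i + l'"
    using mono[of i "i + p"] mono[of i "i + l"] by (simp_all add: p'_def l'_def)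
  have "w [i \<rightarrow> i + l] = w [i + p \<rightarrow> i + p + l]"
    using rep by (intro nth_equalityI) (simp_all add: repeats_def ac_simps)
  moreover have seg: "W [h x \<rightarrow> h y] = concat (map (elem b) (w [x \<rightarrow> y]))" if "x \<le> y" for x y
    unfolding W_def h_def apply_morph_def
    using concat_word_segment[of "\<lambda>i. elem b (w i)" x y] that by (simp add: subsequence_def comp_def)
  ultimately have eq: "W [h i \<rightarrow> h (i + l)] = W [h (i + p) \<rightarrow> h (i + p + l)]" by simp
  then have "length (W [h i \<rightarrow> h (i + l)]) = length (W [h (i + p) \<rightarrow> h (i + p + l)])" by simp
  then have fin: "h (i + p + l) = h i + l' + p'"
    using p' l' mono[of "i + p" "i + p + l"] by simp
  have "repeats W (h i) p' (Suc l')"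
    unfolding repeats_def
  proof (intro allI impI)
    fix k assume "k < Suc l'"
    then consider "k < l'" | "k = l'" by linarith
    then show "W (h i + k) = W (h i + k + p')"
    proof cases
      case 1
      then have "W [h i \<rightarrow> h (i + l)] ! k = W (h i + k)" using l' by simp
      moreover have "W [h (i + p) \<rightarrow> h (i + p + l)] ! k = W (h (i + p) + k)"
        using 1 p' l' fin by simp
      ultimately show ?thesis using eq p' by (simp add: ac_simps)
    next
      case 2
      then show ?thesis
        using image_at[of b w "i + l"] image_at[of b w "i + p + l"] l' fin
        unfolding W_def h_def by (simp add: ac_simps)
    qed
  qed
  moreover have "sum_list (map f (W [h i \<rightarrow> h i + p'])) = sum_list (map (pull b f) (w [i \<rightarrow> i + p]))" for f
    using image_weight[of i "i + p" f b w] p' by (simp add: W_def h_def)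
  moreover have "sum_list (map f (W [h i \<rightarrow> h i + Suc l'])) = sum_list (map (pull b f) (w [i \<rightarrow> i + l])) + f b" for f
  proof -
    have "W [h i \<rightarrow> h i + Suc l'] = W [h i \<rightarrow> h (i + l)] @ [W (h (i + l))]"
      using l' by (simp add: subsequence_def)
    then show ?thesis
      using image_weight[of i "i + l" f b w] image_at[of b w "i + l"] by (simp add: W_def h_def)
  qed
  ultimately show thesis using that by blast
qed


subsection \<open>Towers of elementary morphisms\<close>

text \<open>The weight under \<open>f\<close> of the image at level 0 of a letter of level
  \<open>k\<close>.\<close>

primrec level_weight :: "(nat \<Rightarrow> bit) \<Rightarrow> (bit \<Rightarrow> nat) \<Rightarrow> nat \<Rightarrow> bit \<Rightarrow> nat" where
  "level_weight c f 0 = f"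
| "level_weight c f (Suc k) = pull (c k) (level_weight c f k)"

text \<open>From level \<open>Suc k\<close> down to \<open>k\<close>, the sum of the letter weights
  loses exactly the \<open>f b\<close> that the overlap gains. So overlap weight plus this sum is
  preserved by substitution and does not decrease under desubstitution.\<close>

lemma pull_sum: "pull b f 0 + pull b f 1 = f 0 + f 1 + f b"
  by (cases b) (auto simp: pull_def)

locale tower =
  fixes U :: "nat \<Rightarrow> bit word" and c :: "nat \<Rightarrow> bit"
  assumes level_step: "U k = apply_morph (elem (c k)) (U (Suc k))"
begin

lemma ascend:
  assumes "repeats (U 0) i p l" "0 < p"
  shows "\<exists>k i' p' l'. (l' = 0 \<or> k = K) \<and> 0 < p' \<and> repeats (U k) i' p' l' \<and>
    (\<forall>f. sum_list (map f (U 0 [i \<rightarrow> i + p])) =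
       sum_list (map (level_weight c f k) (U k [i' \<rightarrow> i' + p']))) \<and>
    (\<forall>f. sum_list (map f (U 0 [i \<rightarrow> i + l])) + f 0 + f 1 \<le>
       sum_list (map (level_weight c f k) (U k [i' \<rightarrow> i' + l'])) + level_weight c f k 0 + level_weight c f k 1)"
proof (induction K)
  case 0
  show ?case using assms by (intro exI[of _ 0] exI[of _ i] exI[of _ p] exI[of _ l]) simp
next
  case (Suc K)
  then obtain k i' p' l' where *: "l' = 0 \<or> k = K" "0 < p'" "repeats (U k) i' p' l'"
    "\<And>f. sum_list (map f (U 0 [i \<rightarrow> i + p])) =
       sum_list (map (level_weight c f k) (U k [i' \<rightarrow> i' + p']))"
    "\<And>f. sum_list (map f (U 0 [i \<rightarrow> i + l])) + f 0 + f 1 \<le>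
       sum_list (map (level_weight c f k) (U k [i' \<rightarrow> i' + l'])) + level_weight c f k 0 + level_weight c f k 1"
    by blast
  show ?case
  proof (cases "l' = 0")
    case True
    then show ?thesis using * by blast
  next
    case False
    then have k: "k = K" using *(1) by simp
    have rep: "repeats (apply_morph (elem (c K)) (U (Suc K))) i' p' l'"
      using *(3) level_step[of K] k by simp
    obtain i'' p'' l'' where **: "repeats (U (Suc K)) i'' p'' l''" "0 < p''"
      "\<And>f. sum_list (map f (U K [i' \<rightarrow> i' + p'])) =
         sum_list (map (pull (c K) f) (U (Suc K) [i'' \<rightarrow> i'' + p'']))"
      "\<And>f. sum_list (map f (U K [i' \<rightarrow> i' + l'])) \<le>
         sum_list (map (pull (c K) f) (U (Suc K) [i'' \<rightarrow> i'' + l''])) + f (c K)"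
      using desubstitute_repeats[OF rep] False *(2) level_step[of K] by auto
    have "sum_list (map f (U 0 [i \<rightarrow> i + l])) + f 0 + f 1 \<le>
       sum_list (map (level_weight c f (Suc K)) (U (Suc K) [i'' \<rightarrow> i'' + l''])) +
         level_weight c f (Suc K) 0 + level_weight c f (Suc K) 1" for f
      using *(5)[of f] **(4)[of "level_weight c f K"] pull_sum[of "c K" "level_weight c f K"] k by simp
    then show ?thesis using ** *(4) k
      by (intro exI[of _ "Suc K"] exI[of _ i''] exI[of _ p''] exI[of _ l'']) simp
  qed
qed

text \<open>A root at level \<open>K\<close> contains a letter, whose image alone would be longer
  than \<open>p\<close>. So the ascent cannot end at \<open>K\<close>, and the overlap has vanished
  instead.\<close>

lemma ascend_fully:
  assumes "repeats (U 0) i p l" "0 < p" and large: "\<And>x. p < level_weight c (\<lambda>_. 1) K x"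
  obtains k i' p' where "0 < p'"
    "\<And>f. sum_list (map f (U 0 [i \<rightarrow> i + p])) =
       sum_list (map (level_weight c f k) (U k [i' \<rightarrow> i' + p']))"
    "l + 2 \<le> level_weight c (\<lambda>_. 1) k 0 + level_weight c (\<lambda>_. 1) k 1"
proof -
  obtain k i' p' l' where *: "l' = 0 \<or> k = K" "0 < p'" "repeats (U k) i' p' l'"
    "\<And>f. sum_list (map f (U 0 [i \<rightarrow> i + p])) =
       sum_list (map (level_weight c f k) (U k [i' \<rightarrow> i' + p']))"
    "\<And>f. sum_list (map f (U 0 [i \<rightarrow> i + l])) + f 0 + f 1 \<le>
       sum_list (map (level_weight c f k) (U k [i' \<rightarrow> i' + l'])) + level_weight c f k 0 + level_weight c f k 1"
    using ascend[OF assms(1,2), of K] by blast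
  have "k \<noteq> K"
  proof
    assume "k = K"
    have "p = (\<Sum>n<p'. level_weight c (\<lambda>_. 1) k (U k (i' + n)))"
      using *(4)[of "\<lambda>_. 1"] unfolding sum_list_subsequence by simp
    moreover have "level_weight c (\<lambda>_. 1) k (U k (i' + 0)) \<le> \<dots>"
      using *(2) by (intro member_le_sum) auto
    ultimately show False using large[of "U k i'"] \<open>k = K\<close> by simp
  qed
  then have "l' = 0" using *(1) by simp
  then have "l + 2 \<le> level_weight c (\<lambda>_. 1) k 0 + level_weight c (\<lambda>_. 1) k 1"
    using *(5)[of "\<lambda>_. 1"] unfolding sum_list_subsequence by simp
  then show thesis using that *(2,4) by blast
qed

lemma descend_repeats:
  assumes "repeats (U k) i p l"
  shows "\<exists>i' p' l'. repeats (U 0) i' p' l' \<and>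
    (\<forall>f. sum_list (map f (U 0 [i' \<rightarrow> i' + p'])) =
       sum_list (map (level_weight c f k) (U k [i \<rightarrow> i + p]))) \<and>
    (\<forall>f. sum_list (map f (U 0 [i' \<rightarrow> i' + l'])) + f 0 + f 1 =
       sum_list (map (level_weight c f k) (U k [i \<rightarrow> i + l])) + level_weight c f k 0 + level_weight c f k 1)"
  using assms
proof (induction k arbitrary: i p l)
  case 0
  then show ?case by (intro exI[of _ i] exI[of _ p] exI[of _ l]) simp
next
  case (Suc k)
  obtain i1 p1 l1 where 1: "repeats (U k) i1 p1 l1"
    "\<And>f. sum_list (map f (U k [i1 \<rightarrow> i1 + p1])) =
       sum_list (map (pull (c k) f) (U (Suc k) [i \<rightarrow> i + p]))"
    "\<And>f. sum_list (map f (U k [i1 \<rightarrow> i1 + l1])) =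
       sum_list (map (pull (c k) f) (U (Suc k) [i \<rightarrow> i + l])) + f (c k)"
    using substitute_repeats[OF Suc.prems, of "c k"] level_step[of k] by metis
  obtain i' p' l' where 2: "repeats (U 0) i' p' l'"
    "\<And>f. sum_list (map f (U 0 [i' \<rightarrow> i' + p'])) =
       sum_list (map (level_weight c f k) (U k [i1 \<rightarrow> i1 + p1]))"
    "\<And>f. sum_list (map f (U 0 [i' \<rightarrow> i' + l'])) + f 0 + f 1 =
       sum_list (map (level_weight c f k) (U k [i1 \<rightarrow> i1 + l1])) + level_weight c f k 0 + level_weight c f k 1"
    using Suc.IH[OF 1(1)] by blast
  have "sum_list (map f (U 0 [i' \<rightarrow> i' + l'])) + f 0 + f 1 =
       sum_list (map (level_weight c f (Suc k)) (U (Suc k) [i \<rightarrow> i + l])) +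
         level_weight c f (Suc k) 0 + level_weight c f (Suc k) 1" for f
    using 2(3)[of f] 1(3)[of "level_weight c f k"] pull_sum[of "c k" "level_weight c f k"] by simp
  then show ?case using 2 1(2) by (intro exI[of _ i'] exI[of _ p'] exI[of _ l']) simp
qed

text \<open>With empty overlap every factor of level \<open>k\<close> is vacuously the root of a
  repetition, so the bound of \<open>ascend_fully\<close> is attained for every root.\<close>

lemma descend:
  obtains i' p' l' where "repeats (U 0) i' p' l'"
    "\<And>f. sum_list (map f (U 0 [i' \<rightarrow> i' + p'])) =
       sum_list (map (level_weight c f k) (U k [i \<rightarrow> i + p]))"
    "l' + 2 = level_weight c (\<lambda>_. 1) k 0 + level_weight c (\<lambda>_. 1) k 1"
proof -
  have "repeats (U k) i p 0" by (simp add: repeats_def)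
  then obtain i' p' l' where *: "repeats (U 0) i' p' l'"
    "\<And>f. sum_list (map f (U 0 [i' \<rightarrow> i' + p'])) =
       sum_list (map (level_weight c f k) (U k [i \<rightarrow> i + p]))"
    "\<And>f. sum_list (map f (U 0 [i' \<rightarrow> i' + l'])) + f 0 + f 1 =
       sum_list (map (level_weight c f k) (U k [i \<rightarrow> i + 0])) + level_weight c f k 0 + level_weight c f k 1"
    using descend_repeats by blast
  have "l' + 2 = level_weight c (\<lambda>_. 1) k 0 + level_weight c (\<lambda>_. 1) k 1"
    using *(3)[of "\<lambda>_. 1"] unfolding sum_list_subsequence by simp
  then show thesis using that *(1,2) by blast
qed

text \<open>\<open>U k'\<close> begins with \<open>c k'\<close>, and each letter occurs in its own
  image, so it persists to all lower levels.\<close>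

lemma level_letter:
  assumes "k \<le> k'"
  shows "\<exists>i. U k i = c k'"
  using assms
proof (induction k rule: inc_induct)
  case base
  show ?case using image_at[of "c k'" "U (Suc k')" 0] level_step[of k'] by metis
next
  case (step k)
  then obtain i where "U (Suc k) i = c k'" by blast
  then show ?case
    using image_at_Suc[of "c k" "U (Suc k)" i] level_step[of k] by (metis (full_types))
qed

lemma level_square:
  assumes "U (Suc k) i = c k"
  shows "\<exists>j. U k j = c k \<and> U k (Suc j) = c k"
  using image_at[of "c k" "U (Suc k)" i] image_at_Suc[of "c k" "U (Suc k)" i] level_step[of k] assms
  by metis

text \<open>The other letter occurs only at the end of a two-letter image. This excludes its higher
  powers as roots.\<close>

lemma level_isolated:
  assumes "U k i \<noteq> c k"
  shows "U k (Suc i) = c k"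
proof -
  obtain j where j: "i = Suc (image_pos (c k) (U (Suc k)) j)"
    using assms level_step[of k] image_pos_of_neq[of "c k" "U (Suc k)" i] by metis
  then have "U (Suc k) j \<noteq> c k"
    using assms level_step[of k] image_at_Suc[of "c k" "U (Suc k)" j] by auto
  then have "Suc i = image_pos (c k) (U (Suc k)) (Suc j)" using j by (simp add: elem_def)
  then show ?thesis using image_at[of "c k" "U (Suc k)" "Suc j"] level_step[of k] by metis
qed

end

text \<open>A directive sequence relates each \<open>U n\<close> only to \<open>u\<close>;
  cancelling the first \<open>n\<close> morphisms by injectivity relates consecutive levels.\<close>

lemma directive_tower:
  assumes dir: "directive_sequence u \<Delta>" and \<Delta>: "\<And>k. \<Delta> k = elem (c k)"
  obtains U where "tower U c" "U 0 = u"
proof -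
  obtain U where U: "\<And>n. u = apply_morphs \<Delta> n (U n)"
    using dir unfolding directive_sequence_def by blast
  have step: "apply_morphs \<Delta> (Suc n) w = apply_morphs \<Delta> n (apply_morph (elem (c n)) w)" for n w
    by (simp add: apply_morphs_def \<Delta>)
  have inj: "w = w'" if "apply_morphs \<Delta> n w = apply_morphs \<Delta> n w'" for n w w'
    using that
  proof (induction n arbitrary: w w')
    case 0
    then show ?case by (simp add: apply_morphs_def)
  next
    case (Suc n)
    then show ?case using apply_morph_elem_inj unfolding step by blast
  qed
  have "U k = apply_morph (elem (c k)) (U (Suc k))" for k
    using inj[of k] U[of k] U[of "Suc k"] unfolding step by metis
  then have "tower U c" by unfold_locales
  moreover have "U 0 = u" using U[of 0] by (simp add: apply_morphs_def)
  ultimately show thesis using that by blast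
qed


subsection \<open>Standard words\<close>

definition run_letter :: "nat \<Rightarrow> bit" where
  "run_letter n = (if even n then 1 else 0)"

lemma run_letter_Suc_Suc [simp]: "run_letter (Suc (Suc n)) = run_letter n"
  and run_letter_Suc_neq [simp]: "run_letter (Suc n) \<noteq> run_letter n"
  by (simp_all add: run_letter_def)

definition run_letters :: "nat word \<Rightarrow> bit word" where
  "run_letters a = concat_word (\<lambda>n. replicate (a n) (run_letter n))"

abbreviation run_start :: "nat word \<Rightarrow> nat \<Rightarrow> nat" where
  "run_start a \<equiv> offset (\<lambda>n. replicate (a n) (run_letter n))"

text \<open>
  Weights of the standard words with the index shifted by one: \<open>std_weight a f n\<close> belongs to
  \<open>s\<^bsub>n-1\<^esub>\<close>, where \<open>s\<^bsub>-1\<^esub> = 0\<close> and \<open>s\<^sub>0 = 1\<close>.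
\<close>

fun std_weight :: "nat word \<Rightarrow> (bit \<Rightarrow> nat) \<Rightarrow> nat \<Rightarrow> nat" where
  "std_weight a f 0 = f 0"
| "std_weight a f (Suc 0) = f 1"
| "std_weight a f (Suc (Suc n)) = a n * std_weight a f (Suc n) + std_weight a f n"

abbreviation std_length :: "nat word \<Rightarrow> nat \<Rightarrow> nat" where
  "std_length a \<equiv> std_weight a (\<lambda>_. 1)"

abbreviation std_ones :: "nat word \<Rightarrow> nat \<Rightarrow> nat" where
  "std_ones a \<equiv> std_weight a (\<lambda>x. if x = 1 then 1 else 0)"

context
  fixes a :: "nat word"
  assumes pos: "\<forall>i. 0 < a i"
begin

lemma run_letters_at: "j < a n \<Longrightarrow> run_letters a (run_start a n + j) = run_letter n"
  unfolding run_letters_def using pos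
  by (subst concat_word_at) simp_all

lemma run_cases:
  obtains n j where "k = run_start a n + j" "j < a n"
  using offset_cases[of "\<lambda>n. replicate (a n) (run_letter n)" k] pos by auto

lemma alternating_runs_eq: "alternating_runs a k = elem (run_letters a k)"
proof -
  obtain n j where nj: "k = run_start a n + j" "j < a n" by (rule run_cases)
  let ?B = "\<lambda>n. replicate (a n) (if even n then morph_G else morph_D)"
  have "offset ?B n = run_start a n"
    by (induction n) simp_all
  moreover have "concat_word ?B (offset ?B n + j) = ?B n ! j"
    using pos nj(2) by (intro concat_word_at) simp_all
  ultimately show ?thesis
    using nj run_letters_at[OF nj(2)]
    by (simp add: alternating_runs_def run_letter_def morph_G_eq morph_D_eq)
qed

text \<open>After \<open>j\<close> steps of run \<open>n\<close> the letter of the run stands for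
  s_n, the other one for s_{n-1} and \<open>j\<close> copies of s_n. At \<open>j = a n\<close> the
  latter is s_{n+1}, and the letters exchange roles for the next run.\<close>

lemma level_weight_run:
  assumes "j \<le> a n"
  shows "level_weight (run_letters a) f (run_start a n + j) (run_letter n) = std_weight a f (Suc n)"
    and "level_weight (run_letters a) f (run_start a n + j) (run_letter (Suc n)) =
      std_weight a f n + j * std_weight a f (Suc n)"
proof -
  let ?P = "\<lambda>n j. level_weight (run_letters a) f (run_start a n + j) (run_letter n) =
      std_weight a f (Suc n) \<and>
    level_weight (run_letters a) f (run_start a n + j) (run_letter (Suc n)) =
      std_weight a f n + j * std_weight a f (Suc n)"
  have run: "?P n j" if "?P n 0" "j \<le> a n" for n j
    using that(2)
  proof (induction j)
    case 0
    show ?case by (rule that(1))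
  next
    case (Suc j)
    then show ?case using run_letters_at[of j n] by (simp add: pull_def)
  qed
  have "?P n 0" for n
  proof (induction n)
    case 0
    show ?case by (simp add: run_letter_def)
  next
    case (Suc n)
    then show ?case using run[of n "a n"] by simp
  qed
  then show "level_weight (run_letters a) f (run_start a n + j) (run_letter n) = std_weight a f (Suc n)"
    and "level_weight (run_letters a) f (run_start a n + j) (run_letter (Suc n)) =
      std_weight a f n + j * std_weight a f (Suc n)"
    using run assms by blast+
qed

lemma std_length_pos: "0 < std_length a n"
  by (induction n rule: induct_nat_012) auto

lemma std_length_mono: "std_length a n \<le> std_length a (Suc n)"
proof (cases n)
  case (Suc m)
  have "1 * std_length a (Suc m) \<le> a m * std_length a (Suc m)"
    using pos by (intro mult_right_mono) (auto simp: Suc_le_eq)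
  then show ?thesis unfolding Suc std_weight.simps by linarith
qed simp

lemma std_length_ge: "n \<le> std_length a n"
proof (induction n rule: induct_nat_012)
  case (ge2 n)
  have "1 * std_length a (Suc n) \<le> a n * std_length a (Suc n)"
    using pos by (intro mult_right_mono) (auto simp: Suc_le_eq)
  then show ?case using ge2 std_length_pos[of n] unfolding std_weight.simps by linarith
qed simp_all

end


subsection \<open>Critical exponents of Rote sequences\<close>

text \<open>Telescoping modulo 2: the letters of \<open>sum_word v\<close> in the window add up to
  \<open>v i + v (i + n)\<close>.\<close>

lemma sum_word_parity:
  fixes v :: "bit word"
  shows "v (i + n) = v i \<longleftrightarrow>
    even (sum_list (map (\<lambda>x. if x = 1 then 1 else 0 :: nat) (sum_word v [i \<rightarrow> i + n])))"
  unfolding sum_list_subsequence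
proof (induction n)
  case (Suc n)
  show ?case
    using Suc by (cases "v i"; cases "v (i + n)"; cases "v (Suc (i + n))") (auto simp: sum_word_def)
qed simp

lemma critical_exponent_le:
  fixes v :: "bit word"
  assumes bound: "\<And>i p l. 0 < p \<Longrightarrow> repeats (sum_word v) i p l \<Longrightarrow>
      even (sum_list (map (\<lambda>x. if x = 1 then 1 else 0 :: nat) (sum_word v [i \<rightarrow> i + p]))) \<Longrightarrow>
      real (p + l + 1) \<le> C * real p"
    and C: "1 \<le> C"
  shows "critical_exponent v \<le> ereal C"
  unfolding critical_exponent_def index_def
proof (intro SUP_least, clarify)
  fix x z and e :: rat
  assume z: "z \<in> language v" and pw: "is_power z x e"
  obtain i j where ij: "z = v [i \<rightarrow> j]" using z unfolding language_def by blast
  define p where "p = length x"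
  have p: "0 < p" and e: "e = of_nat (length z) / of_nat p" and zx: "z = prefix (length z) (x\<^sup>\<omega>)"
    using pw unfolding is_power_def p_def by auto
  have vx: "v (i + k) = x ! (k mod p)" if "k < length z" for k
  proof -
    have "z ! k = x ! (k mod p)"
      using that p by (subst zx) (simp add: p_def)
    then show ?thesis using that ij by simp
  qed
  have "real (length z) \<le> C * real p"
  proof (cases "length z \<le> p")
    case True
    then show ?thesis using C mult_right_mono[of 1 C "real p"] by simp
  next
    case False
    \<comment> \<open>The power gives \<open>l + 1\<close> equalities of letters of \<open>v\<close>
      at distance \<open>p\<close>, hence \<open>l\<close> equalities of sums.\<close>
    define l where "l = length z - p - 1"
    have l: "length z = p + l + 1" using False l_def by simp
    have per: "v (i + k) = v (i + k + p)" if "k \<le> l" for k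
      using vx[of k] vx[of "k + p"] that l by (simp add: ac_simps)
    have "repeats (sum_word v) i p l"
      unfolding repeats_def sum_word_def
    proof (intro allI impI)
      fix k assume "k < l"
      then show "v (i + k) + v (Suc (i + k)) = v (i + k + p) + v (Suc (i + k + p))"
        using per[of k] per[of "Suc k"] by simp
    qed
    then show ?thesis using bound[of p i l] p per[of 0] sum_word_parity[of v i p] l by simp
  qed
  then have "real_of_rat e \<le> C"
    using p unfolding e by (simp add: of_rat_divide divide_le_eq)
  then show "ereal (real_of_rat e) \<le> ereal C" by simp
qed

text \<open>Even parity gives one equality of letters of \<open>v\<close> at distance
  \<open>p\<close>; each of the \<open>l\<close> equalities of sums carries it one position
  further.\<close>

lemma critical_exponent_ge:
  fixes v :: "bit word"
  assumes rep: "repeats (sum_word v) i p l" and p: "0 < p"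
    and ev: "even (sum_list (map (\<lambda>x. if x = 1 then 1 else 0 :: nat) (sum_word v [i \<rightarrow> i + p])))"
  shows "ereal (real (p + l + 1) / real p) \<le> critical_exponent v"
proof -
  have per: "v (i + k + p) = v (i + k)" if "k \<le> l" for k
    using that
  proof (induction k)
    case 0
    then show ?case using ev sum_word_parity[of v i p] by simp
  next
    case (Suc k)
    have "v (i + k) + v (Suc (i + k)) = v (i + k + p) + v (Suc (i + k + p))"
      using rep Suc.prems unfolding repeats_def sum_word_def by simp
    then show ?case using Suc
      by (cases "v (i + k)"; cases "v (Suc (i + k))"; cases "v (Suc (i + k + p))") simp_all
  qed
  define x where "x = v [i \<rightarrow> i + p]"
  define z where "z = v [i \<rightarrow> i + (p + l + 1)]"
  have x: "length x = p" "x \<noteq> []" using p by (simp_all add: x_def)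
  have z: "length z = p + l + 1" by (simp add: z_def)
  have vx: "v (i + k) = x ! (k mod p)" if "k < p + l + 1" for k
    using that
  proof (induction k rule: less_induct)
    case (less k)
    show ?case
    proof (cases "k < p")
      case True
      then show ?thesis by (simp add: x_def)
    next
      case False
      then have "v (i + k) = v (i + (k - p))" using per[of "k - p"] less.prems by simp
      also have "\<dots> = x ! ((k - p) mod p)" using less.IH[of "k - p"] less.prems False p by simp
      finally show ?thesis using False by (simp add: le_mod_geq)
    qed
  qed
  have "z = prefix (length z) (x\<^sup>\<omega>)"
  proof (rule nth_equalityI)
    fix k assume "k < length z"
    then have "z ! k = v (i + k)" "prefix (length z) (x\<^sup>\<omega>) ! k = x ! (k mod p)"
      using x p by (simp_all add: z_def del: subseq_to_Suc)
    then show "z ! k = prefix (length z) (x\<^sup>\<omega>) ! k"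
      using vx[of k] \<open>k < length z\<close> z by simp
  qed simp
  then have "is_power z x (of_nat (p + l + 1) / of_nat p)"
    unfolding is_power_def using x z by simp
  moreover have "z \<in> language v" "x \<in> language v"
    unfolding language_def z_def x_def by blast+
  ultimately have "ereal (real_of_rat (of_nat (p + l + 1) / of_nat p)) \<le> index v x"
    unfolding index_def by (intro SUP_upper) blast
  also have "\<dots> \<le> critical_exponent v"
    unfolding critical_exponent_def using \<open>x \<in> language v\<close> x by (intro SUP_upper) blast
  finally show ?thesis by (simp add: of_rat_divide of_rat_add)
qed


subsection \<open>Block decompositions\<close>

text \<open>
  The longest repetition in \<open>u\<close> with root \<open>s\<^sub>n\<close> has length
  \<open>2 \<bar>s\<^sub>n\<bar> + \<bar>s\<^bsub>n+1\<^esub>\<bar> - 2\<close>. One more letter in \<open>v\<close> must give an exponent below \<open>7/2\<close> with respect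
  to the period \<open>\<bar>s\<^sub>n\<bar>\<close> if \<open>s\<^sub>n\<close> has an even number of ones, and to \<open>2 \<bar>s\<^sub>n\<bar>\<close> otherwise.
\<close>

definition admissible :: "nat word \<Rightarrow> nat \<Rightarrow> bool" where
  "admissible a n \<longleftrightarrow>
    (if even (std_ones a (Suc n)) then 2 * std_length a (Suc (Suc n)) < 3 * std_length a (Suc n) + 2
     else std_length a (Suc (Suc n)) \<le> 5 * std_length a (Suc n))"

definition block_start :: "nat word \<Rightarrow> nat \<Rightarrow> bool" where
  "block_start a n \<longleftrightarrow> even (std_ones a n) \<and> odd (std_ones a (Suc n))"

lemma even_std_ones_Suc_Suc:
  "even (std_ones a (Suc (Suc n))) \<longleftrightarrow> (even (a n * std_ones a (Suc n)) \<longleftrightarrow> even (std_ones a n))"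
  by simp

lemma block_start_0: "block_start a 0"
  by (simp add: block_start_def)

section \<open>Admissibility as a condition on the exponents\<close>

context
  fixes a :: "nat word"
  assumes pos: "\<forall>i. 0 < a i"
begin

text \<open>The length of s_{n+1} lies strictly above \<open>a n\<close> times and is at most
  \<open>a n + 1\<close> times the length of s_n.\<close>

lemma admissible_odd:
  assumes "odd (std_ones a (Suc n))"
  shows "admissible a n \<longleftrightarrow> a n \<le> 4"
proof
  assume "admissible a n"
  then have le: "a n * std_length a (Suc n) + std_length a n \<le> 5 * std_length a (Suc n)"
    using assms by (simp add: admissible_def)
  show "a n \<le> 4"
  proof (rule ccontr)
    assume "\<not> a n \<le> 4"
    then have "5 * std_length a (Suc n) \<le> a n * std_length a (Suc n)"
      by (intro mult_right_mono) auto
    then show False using le std_length_pos[OF pos, of n] by linarith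
  qed
next
  assume "a n \<le> 4"
  then have "a n * std_length a (Suc n) \<le> 4 * std_length a (Suc n)"
    by (intro mult_right_mono) auto
  then have "a n * std_length a (Suc n) + std_length a n \<le> 5 * std_length a (Suc n)"
    using std_length_mono[OF pos, of n] by linarith
  then show "admissible a n" using assms by (simp add: admissible_def)
qed

text \<open>A next exponent of 2 or more makes the ratio too large. With exponent 1 the condition
  holds if \<open>2 \<le> a m\<close>; if \<open>a m = 1\<close>, it says that the previous length
  grew by at most 1. That happens only at the start, where parity leaves just the prefix
  111.\<close>

lemma admissible_even:
  assumes "even (std_ones a (Suc (Suc m)))"
  shows "admissible a (Suc m) \<longleftrightarrow>
    a (Suc m) = 1 \<and> (2 \<le> a m \<or> m = 1 \<and> a 0 = 1 \<and> a 1 = 1)"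
proof -
  define Q where "Q = std_length a"
  have Q: "Q (Suc (Suc k)) = a k * Q (Suc k) + Q k" "0 < Q k" "k \<le> Q k" for k
    using std_length_pos[OF pos, of k] std_length_ge[OF pos, of k] by (simp_all add: Q_def)
  have "admissible a (Suc m) \<longleftrightarrow> 2 * (a (Suc m) * Q (Suc (Suc m)) + Q (Suc m)) < 3 * Q (Suc (Suc m)) + 2"
    using assms unfolding admissible_def Q_def by (simp only: std_weight.simps if_True)
  also have "\<dots> \<longleftrightarrow> a (Suc m) = 1 \<and> 2 * Q (Suc m) < Q (Suc (Suc m)) + 2"
  proof
    assume *: "2 * (a (Suc m) * Q (Suc (Suc m)) + Q (Suc m)) < 3 * Q (Suc (Suc m)) + 2"
    have "\<not> 2 \<le> a (Suc m)"
    proof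
      assume "2 \<le> a (Suc m)"
      then have "2 * Q (Suc (Suc m)) \<le> a (Suc m) * Q (Suc (Suc m))"
        by (intro mult_right_mono) auto
      then have "4 * Q (Suc (Suc m)) + 2 * Q (Suc m) < 3 * Q (Suc (Suc m)) + 2"
        using * unfolding distrib_left by linarith
      then show False using Q(2)[of "Suc m"] Q(2)[of "Suc (Suc m)"] by linarith
    qed
    moreover have "0 < a (Suc m)" using pos by blast
    ultimately have "a (Suc m) = 1" by linarith
    then show "a (Suc m) = 1 \<and> 2 * Q (Suc m) < Q (Suc (Suc m)) + 2" using * by simp
  qed auto
  also have "\<dots> \<longleftrightarrow> a (Suc m) = 1 \<and> (2 \<le> a m \<or> m = 1 \<and> a 0 = 1 \<and> a 1 = 1)"
  proof (cases "2 \<le> a m")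
    case True
    then have "2 * Q (Suc m) \<le> a m * Q (Suc m)" by (intro mult_right_mono) auto
    then have "2 * Q (Suc m) < Q (Suc (Suc m)) + 2" using Q(1)[of m] by linarith
    then show ?thesis using True by simp
  next
    case False
    moreover have "0 < a m" using pos by blast
    ultimately have am: "a m = 1" by linarith
    show ?thesis
    proof (cases m)
      case 0
      then show ?thesis using assms am by simp
    next
      case (Suc k)
      have "2 * Q (Suc m) < Q (Suc (Suc m)) + 2 \<longleftrightarrow> a k * Q (Suc k) + Q k < Q (Suc k) + 2"
        using Q(1)[of m] Q(1)[of k] am Suc by (simp add: add.commute)
      also have "\<dots> \<longleftrightarrow> k = 0 \<and> a k = 1"
      proof
        assume *: "a k * Q (Suc k) + Q k < Q (Suc k) + 2"
        have "0 < a k" using pos by blast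
        then have "1 * Q (Suc k) \<le> a k * Q (Suc k)" by (intro mult_right_mono) auto
        then have "Q k = 1" using * Q(2)[of k] by linarith
        have "\<not> 2 \<le> a k"
        proof
          assume "2 \<le> a k"
          then have "2 * Q (Suc k) \<le> a k * Q (Suc k)" by (intro mult_right_mono) auto
          then show False using * Q(2)[of k] Q(2)[of "Suc k"] by linarith
        qed
        then have ak: "a k = 1" using \<open>0 < a k\<close> by linarith
        \<comment> \<open>Lengths alone allow \<open>k = 1\<close>, as s_{-1} and s_0 both have
          length 1; parity excludes it.\<close>
        have "k \<noteq> 1"
        proof
          assume "k = 1"
          then have "std_ones a (Suc (Suc m)) = Suc (2 * a 0)"
            using am ak Suc by simp
          then show False using assms by simp
        qed
        then show "k = 0 \<and> a k = 1" using ak Q(3)[of k] \<open>Q k = 1\<close> by linarith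
      next
        assume "k = 0 \<and> a k = 1"
        then show "a k * Q (Suc k) + Q k < Q (Suc k) + 2" by (auto simp: Q_def)
      qed
      finally show ?thesis using am Suc False by auto
    qed
  qed
  finally show ?thesis .
qed

section \<open>Reading blocks off admissible exponents\<close>

lemma odd_phase:
  assumes "block_start a n" and "odd (a n)" and "\<And>i. i < k \<Longrightarrow> even (a (Suc n + i))"
  shows "odd (std_ones a (Suc n + k)) \<and> odd (std_ones a (Suc (Suc n + k)))"
  using assms(3)
\<comment> \<open>From parities (even, odd) an odd exponent leads to (odd, odd), which even
  exponents preserve.\<close>
proof (induction k)
  case 0
  then show ?case using assms(1,2) by (simp add: block_start_def)
next
  case (Suc k)
  then have "odd (std_ones a (Suc n + k))" "odd (std_ones a (Suc (Suc n + k)))"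
    using less_Suc_eq by blast+
  moreover have "even (a (Suc n + k))" using Suc.prems by blast
  ultimately show ?case unfolding add_Suc_right even_std_ones_Suc_Suc by simp
qed

text \<open>The parity automaton: an even first exponent yields an even word, which forces a closing
  1 and gives \<open>L1\<close>. An odd one enters the odd phase; the first later exponent outside
  {2, 4} is odd, yields an even word and again forces a closing 1. Staying in the odd phase forever
  is \<open>L3\<close>.\<close>

lemma next_block:
  assumes adm: "\<And>n. admissible a n" and start: "block_start a n" and no_tail: "suffix n a \<notin> L3"
  shows "\<exists>m>n. block_start a m \<and> a [n \<rightarrow> m] \<in> L0 \<union> L1 \<union> L2 \<and> (a [n \<rightarrow> m] \<in> L0 \<longrightarrow> n = 0)"
proof -
  have odd_le: "odd (std_ones a (Suc k)) \<Longrightarrow> a k \<le> 4" for k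
    using admissible_odd adm by blast
  have an: "0 < a n" "a n \<le> 4" using pos odd_le start by (auto simp: block_start_def)
  show ?thesis
  proof (cases "even (a n)")
    case True
    then have ev: "even (std_ones a (Suc (Suc n)))"
      using start unfolding block_start_def even_std_ones_Suc_Suc by simp
    then have 1: "a (Suc n) = 1" using admissible_even adm by blast
    have "odd (std_ones a (Suc (Suc (Suc n))))"
      using ev start 1 unfolding block_start_def even_std_ones_Suc_Suc[of a "Suc n"] by simp
    then have "block_start a (Suc (Suc n))" using ev unfolding block_start_def by blast
    moreover have "a n = 2 \<or> a n = 4" using True an by presburger
    then have "[a n, 1] \<in> L1" by (auto simp: L1_def)
    then have "a [n \<rightarrow> Suc (Suc n)] \<in> L1" using 1 by simp
    moreover have "a [n \<rightarrow> Suc (Suc n)] \<notin> L0" by (simp add: L0_def)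
    ultimately show ?thesis by (intro exI[of _ "Suc (Suc n)"]) auto
  next
    case False
    then have c: "a n \<in> {1, 3}" using an by simp presburger
    have "\<exists>k. a (Suc n + k) \<notin> {2, 4}"
    proof (rule ccontr)
      assume "\<not> ?thesis"
      then have "range (suffix (Suc n) a) \<subseteq> {2, 4}" by auto
      moreover have "suffix n a = a n ## suffix (Suc n) a"
        using build_first[of "suffix n a"] by simp
      ultimately show False using no_tail c unfolding L3_def by blast
    qed
    define k where "k = (LEAST k. a (Suc n + k) \<notin> {2, 4})"
    have k: "a (Suc n + k) \<notin> {2, 4}"
      unfolding k_def using \<open>\<exists>k. a (Suc n + k) \<notin> {2, 4}\<close> by (rule LeastI_ex)
    have small: "a (Suc n + i) \<in> {2, 4}" if "i < k" for i
      using not_less_Least that unfolding k_def by blast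
    then have "even (a (Suc n + i))" if "i < k" for i using small[OF that] by auto
    then have odd: "odd (std_ones a (Suc n + k))" "odd (std_ones a (Suc (Suc n + k)))"
      using odd_phase[OF start False, of k] by blast+
    have le: "0 < a (Suc n + k)" "a (Suc n + k) \<le> 4" using pos odd_le odd by blast+
    then have "odd (a (Suc n + k))" using k by simp presburger
    then have ev: "even (std_ones a (Suc (Suc (Suc n + k))))"
      using odd unfolding even_std_ones_Suc_Suc by simp
    \<comment> \<open>The exponent before the closing 1 is therefore 3, except when
      \<open>n = k = 0\<close>, which is the prefix 111.\<close>
    then have 1: "a (Suc (Suc n + k)) = 1"
      and alt: "2 \<le> a (Suc n + k) \<or> Suc n + k = 1 \<and> a 0 = 1 \<and> a 1 = 1"
      using admissible_even adm by blast+
    have "odd (std_ones a (Suc (Suc (Suc (Suc n + k)))))"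
      using ev odd 1 unfolding even_std_ones_Suc_Suc[of a "Suc (Suc n + k)"] by simp
    then have next_start: "block_start a (n + k + 3)"
      using ev unfolding block_start_def by (simp add: numeral_3_eq_3)
    define s where "s = a [Suc n \<rightarrow> Suc n + k]"
    have seg: "a [n \<rightarrow> n + k + 3] = [a n] @ s @ [a (Suc n + k), 1]"
    proof -
      have "a [n \<rightarrow> n + k + 3] = a [n \<rightarrow> Suc n + k] @ [a (Suc n + k), a (Suc (Suc n + k))]"
        by (simp add: numeral_3_eq_3)
      moreover have "a [n \<rightarrow> Suc n + k] = a n # s"
        unfolding s_def subsequence_def by (subst upt_conv_Cons) simp_all
      ultimately show ?thesis using 1 by simp
    qed
    have s: "set s \<subseteq> {2, 4}"
    proof
      fix x assume "x \<in> set s"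
      then obtain i where "x = a i" "Suc n \<le> i" "i < Suc n + k" by (auto simp: s_def)
      then show "x \<in> {2, 4}" using small[of "i - Suc n"] by simp
    qed
    show ?thesis
    proof (cases "2 \<le> a (Suc n + k)")
      case True
      then have "a (Suc n + k) = 3" using le k by simp
      then have "a [n \<rightarrow> n + k + 3] \<in> L2" using seg s c unfolding L2_def by auto
      moreover have "a [n \<rightarrow> n + k + 3] \<notin> L0"
        using seg \<open>a (Suc n + k) = 3\<close> by (auto simp: L0_def append_eq_Cons_conv)
      ultimately show ?thesis using next_start by (intro exI[of _ "n + k + 3"]) auto
    next
      case False
      then have "n = 0" "k = 0" "a 0 = 1" "a 1 = 1" using alt by auto
      then have "a [n \<rightarrow> n + k + 3] \<in> L0" using seg by (simp add: L0_def s_def)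
      then show ?thesis using next_start \<open>n = 0\<close> by (intro exI[of _ "n + k + 3"]) auto
    qed
  qed
qed

text \<open>Blocks are cut off successively from position 0, either forever or up to the first cut
  point whose remaining word is in \<open>L3\<close>.\<close>

lemma admissible_imp_block_concatenation:
  assumes adm: "\<And>n. admissible a n"
  shows "block_concatenation a"
proof -
  define step where "step n m \<longleftrightarrow> n < m \<and> block_start a m \<and> a [n \<rightarrow> m] \<in> L0 \<union> L1 \<union> L2 \<and>
    (a [n \<rightarrow> m] \<in> L0 \<longrightarrow> n = 0)" for n m
  have "\<exists>m. step n m" if "block_start a n" "suffix n a \<notin> L3" for n
    unfolding step_def using next_block[of n, OF adm that] .
  note step_ex = this
  define nxt where "nxt n = (SOME m. step n m)" for n
  have nxt_step: "step n (nxt n)" if "block_start a n" "suffix n a \<notin> L3" for n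
    unfolding nxt_def by (rule someI_ex[of "step n"]) (rule step_ex[OF that])
  have nxt: "n < nxt n \<and> block_start a (nxt n) \<and> a [n \<rightarrow> nxt n] \<in> L0 \<union> L1 \<union> L2 \<and>
      (a [n \<rightarrow> nxt n] \<in> L0 \<longrightarrow> n = 0)" if "block_start a n" "suffix n a \<notin> L3" for n
    using nxt_step[OF that] unfolding step_def .
  define t where "t i = (nxt ^^ i) 0" for i
  have t_Suc: "t (Suc i) = nxt (t i)" and t_0: "t 0 = 0" for i by (simp_all add: t_def)
  have start: "block_start a (t i)" if "\<And>j. j < i \<Longrightarrow> suffix (t j) a \<notin> L3" for i
    using that
  proof (induction i)
    case 0
    show ?case by (simp add: t_0 block_start_0)
  next
    case (Suc i)
    have "block_start a (t i)" using Suc.prems by (intro Suc.IH) simp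
    then have "t i < nxt (t i) \<and> block_start a (nxt (t i)) \<and> a [t i \<rightarrow> nxt (t i)] \<in> L0 \<union> L1 \<union> L2 \<and>
      (a [t i \<rightarrow> nxt (t i)] \<in> L0 \<longrightarrow> t i = 0)"
      by (rule nxt) (rule Suc.prems, simp)
    then show ?case unfolding t_Suc by (elim conjE)
  qed
  have block: "t i < t (Suc i)" "a [t i \<rightarrow> t (Suc i)] \<in> L0 \<union> L1 \<union> L2"
      "a [t i \<rightarrow> t (Suc i)] \<in> L0 \<Longrightarrow> i = 0"
    if none: "\<And>j. j \<le> i \<Longrightarrow> suffix (t j) a \<notin> L3" for i
  proof -
    have *: "t j < t (Suc j) \<and> a [t j \<rightarrow> t (Suc j)] \<in> L0 \<union> L1 \<union> L2 \<and>
        (a [t j \<rightarrow> t (Suc j)] \<in> L0 \<longrightarrow> t j = 0)" if "j \<le> i" for j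
    proof -
      have "block_start a (t j)" using that by (intro start none) simp
      from nxt[OF this none[OF that]] show ?thesis
        unfolding t_Suc by (elim conjE) (intro conjI)
    qed
    show "t i < t (Suc i)" "a [t i \<rightarrow> t (Suc i)] \<in> L0 \<union> L1 \<union> L2"
      using *[of i] by simp_all
    show "i = 0" if "a [t i \<rightarrow> t (Suc i)] \<in> L0"
    proof (cases i)
      \<comment> \<open>Cut points increase strictly, so only the first block starts at position
        0.\<close>
      case (Suc j)
      then show ?thesis using *[of j] *[of i] that by simp
    qed
  qed
  show ?thesis
  proof (cases "\<exists>i. suffix (t i) a \<in> L3")
    case False
    have "concat_word (\<lambda>i. (a [t i \<rightarrow> t (Suc i)])) = a"
      by (intro concat_word_eqI t_0 block(1)) (use False in blast)
    then show ?thesis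
      unfolding block_concatenation_def
    proof (intro disjI1 exI[of _ "\<lambda>i. (a [t i \<rightarrow> t (Suc i)])"] conjI allI impI)
      show "a [t i \<rightarrow> t (Suc i)] \<in> L0 \<union> L1 \<union> L2" for i
        using block(2) False by blast
      show "i = 0" if "a [t i \<rightarrow> t (Suc i)] \<in> L0" for i
        using block(3) False that by blast
    qed simp
  next
    case True
    define i where "i = (LEAST i. suffix (t i) a \<in> L3)"
    have tail: "suffix (t i) a \<in> L3" unfolding i_def using True by (rule LeastI_ex)
    have none: "suffix (t j) a \<notin> L3" if "j < i" for j
      using not_less_Least that unfolding i_def by blast
    define Bs where "Bs = map (\<lambda>j. a [t j \<rightarrow> t (Suc j)]) [0..<i]"
    have "concat (map (\<lambda>j. a [t j \<rightarrow> t (Suc j)]) [0..<k]) = prefix (t k) a" if "k \<le> i" for k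
      using that
    proof (induction k)
      case 0
      show ?case by (simp add: t_0)
    next
      case (Suc k)
      have "t k < t (Suc k)" using Suc.prems by (intro block(1) none) simp
      then obtain d where "t (Suc k) = t k + d" using less_imp_add_positive by metis
      then show ?case using Suc subsequence_append[where i = "t k" and j = d and w = a] by simp
    qed
    then have "a = concat Bs \<frown> suffix (t i) a"
      unfolding Bs_def using prefix_suffix[of a "t i"] by simp
    moreover have "set Bs \<subseteq> L0 \<union> L1 \<union> L2"
      unfolding Bs_def set_map by (intro image_subsetI block(2) none) simp
    moreover have "j = 0" if "j < i" "a [t j \<rightarrow> t (Suc j)] \<in> L0" for j
      using that(2) by (rule block(3)[rotated]) (use that(1) in \<open>intro none; simp\<close>)
    then have "\<forall>j < length Bs. Bs ! j \<in> L0 \<longrightarrow> j = 0" by (simp add: Bs_def)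
    ultimately show ?thesis unfolding block_concatenation_def using tail by blast
  qed
qed

text \<open>The parities are now computed from the given exponents, after which
  \<open>admissible_odd\<close> and \<open>admissible_even\<close> apply at each position.\<close>

lemma block_admissible:
  assumes start: "block_start a n" and B: "a [n \<rightarrow> n + length B] = B"
    and "B \<in> L0 \<union> L1 \<union> L2" and L0: "B \<in> L0 \<longrightarrow> n = 0"
  shows "block_start a (n + length B) \<and> (\<forall>i. n \<le> i \<and> i < n + length B \<longrightarrow> admissible a i)"
proof -
  have at: "a (n + i) = B ! i" if "i < length B" for i
    using that arg_cong[OF B, of "\<lambda>xs. xs ! i"] by simp
  consider (L0) "B \<in> L0" | (L1) "B \<in> L1" | (L2) "B \<in> L2" using assms(3) by blast
  then show ?thesis
  proof cases
    case L0
    then have "B = [1, 1, 1]" "n = 0" using assms(4) by (auto simp: L0_def)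
    then have a: "a 0 = 1" "a 1 = 1" "a 2 = 1" using at[of 0] at[of 1] at[of 2] by (simp_all add: numeral_2_eq_2)
    have "admissible a 0" "admissible a 1" using a by (simp_all add: admissible_odd)
    moreover have "admissible a 2"
      using a admissible_even[of 1] by (simp add: numeral_2_eq_2)
    ultimately have "admissible a i" if "i < 3" for i
      using that by (metis One_nat_def less_2_cases less_antisym numeral_2_eq_2 numeral_3_eq_3)
    moreover have "std_ones a 3 = 2" "std_ones a 4 = 3" using a by (simp_all add: eval_nat_numeral)
    then have "block_start a 3" by (simp add: block_start_def)
    ultimately show ?thesis using \<open>B = [1, 1, 1]\<close> \<open>n = 0\<close> by (simp add: numeral_3_eq_3)
  next
    case L1
    then obtain s where s: "B = [s, 1]" "s \<in> {2, 4}" by (auto simp: L1_def)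
    then have a: "a n \<in> {2, 4}" "a (Suc n) = 1" using at[of 0] at[of 1] by simp_all
    have ev: "even (std_ones a (Suc (Suc n)))"
      using start a unfolding block_start_def even_std_ones_Suc_Suc by auto
    then have "odd (std_ones a (Suc (Suc (Suc n))))"
      using start a unfolding block_start_def even_std_ones_Suc_Suc[of a "Suc n"] by simp
    moreover have "admissible a n" using start a admissible_odd[of n] by (auto simp: block_start_def)
    moreover have "admissible a (Suc n)" using ev a admissible_even[of n] by auto
    ultimately show ?thesis
      using ev s unfolding block_start_def by (auto simp: less_Suc_eq le_Suc_eq)
  next
    case L2
    then obtain c s where s: "B = [c] @ s @ [3, 1]" "c \<in> {1, 3}" "set s \<subseteq> {2, 4}"
      by (auto simp: L2_def)
    define k where "k = length s"
    have len: "length B = k + 3" using s by (simp add: k_def)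
    have an: "a n \<in> {1, 3}" using at[of 0] s by simp
    have ak: "a (Suc n + i) \<in> {2, 4}" if "i < k" for i
    proof -
      have "a (Suc n + i) = s ! i"
        using at[of "Suc i"] that s by (simp add: k_def nth_append)
      moreover have "s ! i \<in> {2, 4}" using s(3) that nth_mem[of i s] unfolding k_def by blast
      ultimately show ?thesis by simp
    qed
    have a3: "a (Suc n + k) = 3" and a1: "a (Suc (Suc n + k)) = 1"
      using at[of "Suc k"] at[of "Suc (Suc k)"] s len by (simp_all add: k_def nth_append)
    have odd: "odd (std_ones a (Suc n + i)) \<and> odd (std_ones a (Suc (Suc n + i)))" if "i \<le> k" for i
    proof (intro odd_phase start)
      show "odd (a n)" using an by auto
      show "even (a (Suc n + j))" if "j < i" for j
        using ak[of j] that \<open>i \<le> k\<close> by auto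
    qed
    have ev: "even (std_ones a (Suc (Suc (Suc n + k))))"
      using odd[of k] a3 even_std_ones_Suc_Suc[of a "Suc n + k"] by (simp del: std_weight.simps)
    have "odd (std_ones a (Suc (Suc (Suc (Suc n + k)))))"
      using odd[of k] ev a1 unfolding even_std_ones_Suc_Suc[of a "Suc (Suc n + k)"] by simp
    then have "block_start a (n + length B)"
      using ev len unfolding block_start_def by (simp add: numeral_3_eq_3)
    moreover have "admissible a i" if i: "n \<le> i" "i < n + length B" for i
    proof -
      consider "i = n" | j where "i = Suc n + j" "j \<le> k" | "i = Suc (Suc n + k)"
      proof (cases "i = n \<or> i = Suc (Suc n + k)")
        case False
        then have "i = Suc n + (i - Suc n)" "i - Suc n \<le> k" using i len by linarith+
        then show thesis using that(2) by blast
      qed (use that in blast)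
      then show ?thesis
      proof cases
        case 1
        then show ?thesis using an start admissible_odd[of n] by (auto simp: block_start_def)
      next
        case 2
        then have "a i \<le> 4" using ak[of j] a3 by (cases "j = k") auto
        then show ?thesis using 2 odd[of j] admissible_odd[of i] by blast
      next
        case 3
        then show ?thesis using ev a1 a3 admissible_even[of "Suc n + k"] by simp
      qed
    qed
    ultimately show ?thesis by blast
  qed
qed

text \<open>An \<open>L3\<close> tail never leaves the odd phase, where only the bound 4 is
  required.\<close>

lemma tail_admissible:
  assumes start: "block_start a n" and tail: "suffix n a \<in> L3" and "n \<le> i"
  shows "admissible a i"
proof -
  obtain c s where s: "suffix n a = c ## s" "c \<in> {1, 3}" "range s \<subseteq> {2, 4}"
    using tail by (auto simp: L3_def)
  have an: "a n \<in> {1, 3}" using fun_cong[OF s(1), of 0] s(2) by simp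
  have ak: "a (Suc n + k) \<in> {2, 4}" for k
    using fun_cong[OF s(1), of "Suc k"] s(3) by auto
  show ?thesis
  proof (cases "i = n")
    case True
    then show ?thesis using an start admissible_odd[of n] by (auto simp: block_start_def)
  next
    case False
    then have i: "i = Suc n + (i - Suc n)" using \<open>n \<le> i\<close> by simp
    have "odd (a n)" using an by auto
    moreover have "even (a (Suc n + k))" for k using ak[of k] by auto
    ultimately have "odd (std_ones a (Suc (Suc n + (i - Suc n))))"
      using odd_phase[OF start, of "i - Suc n"] by blast
    then show ?thesis using i ak[of "i - Suc n"] admissible_odd[of i] by auto
  qed
qed

lemma block_concatenation_imp_admissible:
  assumes "block_concatenation a"
  shows "admissible a n"
  using assms unfolding block_concatenation_def
proof (elim disjE exE conjE)
  fix B assume B: "\<forall>i. B i \<in> L0 \<union> L1 \<union> L2" "\<forall>i. B i \<in> L0 \<longrightarrow> i = 0" "a = concat_word B"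
  have ne: "B k \<noteq> []" for k
    using spec[OF B(1), of k] by (auto simp: L0_def L1_def L2_def)
  have seg: "a [offset B i \<rightarrow> offset B i + length (B i)] = B i" for i
    using concat_word_segment[of B i "Suc i", OF ne] B(3) by simp
  have "offset B i = 0" if "B i \<in> L0" for i using that B(2) by auto
  then have step: "block_start a (offset B (Suc i)) \<and>
      (\<forall>j. offset B i \<le> j \<and> j < offset B (Suc i) \<longrightarrow> admissible a j)"
    if "block_start a (offset B i)" for i
    using block_admissible[OF that seg] B(1) by simp
  have start: "block_start a (offset B i)" for i
    by (induction i) (use block_start_0 step in auto)
  obtain i k where "n = offset B i + k" "k < length (B i)"
    using offset_cases[of B n] ne by blast
  then show ?thesis using step[OF start[of i]] by simp
next
  fix Bs t
  assume Bs: "set Bs \<subseteq> L0 \<union> L1 \<union> L2" "\<forall>i < length Bs. Bs ! i \<in> L0 \<longrightarrow> i = 0"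
    and t: "t \<in> L3" and a: "a = concat Bs \<frown> t"
  define ofs where "ofs i = length (concat (take i Bs))" for i
  have ofs_Suc: "ofs (Suc i) = ofs i + length (Bs ! i)" if "i < length Bs" for i
    using that by (simp add: ofs_def take_Suc_conv_app_nth)
  have seg: "a [ofs i \<rightarrow> ofs i + length (Bs ! i)] = Bs ! i" if "i < length Bs" for i
  proof -
    have "concat Bs = concat (take i Bs) @ Bs ! i @ concat (drop (Suc i) Bs)"
      using arg_cong[OF id_take_nth_drop[OF that], of concat] by simp
    then have "a = (concat (take i Bs) @ Bs ! i) \<frown> (concat (drop (Suc i) Bs) \<frown> t)"
      using a by simp
    then show ?thesis
      by (intro nth_equalityI) (simp_all add: ofs_def nth_append)
  qed
  have main: "block_start a (ofs i) \<and> (\<forall>j<ofs i. admissible a j)" if "i \<le> length Bs" for i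
    using that
  proof (induction i)
    case 0
    show ?case by (simp add: ofs_def block_start_0)
  next
    case (Suc i)
    then have i: "i < length Bs" by simp
    then have "Bs ! i \<in> L0 \<union> L1 \<union> L2" using Bs(1) nth_mem by blast
    moreover have "Bs ! i \<in> L0 \<longrightarrow> ofs i = 0" using Bs(2) i by (auto simp: ofs_def)
    ultimately have "block_start a (ofs (Suc i)) \<and>
        (\<forall>j. ofs i \<le> j \<and> j < ofs (Suc i) \<longrightarrow> admissible a j)"
      using block_admissible[of "ofs i" "Bs ! i"] seg[OF i] Suc i by (simp add: ofs_Suc)
    moreover have "\<forall>j<ofs i. admissible a j" using Suc i by simp
    ultimately show ?case using linorder_not_le by blast
  qed
  have "suffix (ofs (length Bs)) a \<in> L3" using t a by (simp add: ofs_def)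
  then have "admissible a n" if "ofs (length Bs) \<le> n"
    using main[of "length Bs"] tail_admissible[of "ofs (length Bs)" n] that by blast
  then show ?thesis using main[of "length Bs"] by (cases "n < ofs (length Bs)") auto
qed

end


subsection \<open>The critical exponent along the tower\<close>

lemma run_letter_sum: "f 0 + f 1 = f (run_letter n) + (f (run_letter (Suc n)) :: nat)"
  by (simp add: run_letter_def)

lemma bit_run_letter_cases: "x = run_letter n \<or> x = run_letter (Suc n)"
  by (cases x) (auto simp: run_letter_def)

locale runs_tower = tower U "run_letters a" for U and a :: "nat word" +
  assumes pos: "\<forall>i. 0 < a i"
begin

lemma run_letter_occurs:
  assumes "k \<le> run_start a n"
  shows "\<exists>i. U k i = run_letter n"
  using level_letter[OF assms] run_letters_at[OF pos, of 0 n] pos by simp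

text \<open>The bound says \<open>(p + l + 1) / p < 7 / 2\<close>. It is applied to one repetition
  for each \<open>n\<close>, whose root is s_n or its square, according to parity.\<close>

lemma admissible_of_bound:
  assumes bound: "\<And>i p l. 0 < p \<Longrightarrow> repeats (U 0) i p l \<Longrightarrow>
      even (sum_list (map (\<lambda>x. if x = 1 then 1 else 0 :: nat) (U 0 [i \<rightarrow> i + p]))) \<Longrightarrow>
      2 * l + 2 < 5 * p"
  shows "admissible a n"
proof (cases "even (std_ones a (Suc n))")
  case True
  \<comment> \<open>The last level at which a letter stands for s_n; the other letter stands for
    s_{n+1}. The former occurs because \<open>run_letter n\<close> is also the letter of run
    \<open>n + 2\<close>.\<close>
  define k where "k = run_start a (Suc n)"
  obtain i where i: "U k i = run_letter n"
    using run_letter_occurs[of k "Suc (Suc n)"] by (auto simp: k_def)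
  have w: "level_weight (run_letters a) f k (run_letter n) = std_weight a f (Suc n)"
    "level_weight (run_letters a) f k (run_letter (Suc n)) = std_weight a f (Suc (Suc n))" for f
    using level_weight_run[OF pos, of 0 "Suc n" f] by (simp_all add: k_def)
  obtain i' p' l' where *: "repeats (U 0) i' p' l'"
    "\<And>f. sum_list (map f (U 0 [i' \<rightarrow> i' + p'])) =
       sum_list (map (level_weight (run_letters a) f k) (U k [i \<rightarrow> i + 1]))"
    "l' + 2 = level_weight (run_letters a) (\<lambda>_. 1) k 0 + level_weight (run_letters a) (\<lambda>_. 1) k 1"
    using descend[of k i 1] by blast
  have sum: "sum_list (map f (U 0 [i' \<rightarrow> i' + p'])) = std_weight a f (Suc n)" for f
    using *(2)[of f] i w by simp
  have p: "p' = std_length a (Suc n)"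
    using sum[of "\<lambda>_. 1"] unfolding sum_list_subsequence by simp
  have l: "l' + 2 = std_length a (Suc n) + std_length a (Suc (Suc n))"
    using *(3) w run_letter_sum[of "level_weight (run_letters a) (\<lambda>_. 1) k" n] by simp
  have "2 * l' + 2 < 5 * p'"
    using bound[OF _ *(1)] sum True p std_length_pos[OF pos, of "Suc n"] by simp
  moreover have "2 * y < 3 * x + 2"
    if "2 * l' + 2 < 5 * p'" "l' + 2 = x + y" "p' = x" for x y
    using that by linarith
  ultimately have "2 * std_length a (Suc (Suc n)) < 3 * std_length a (Suc n) + 2"
    using l p by blast
  then show ?thesis using True by (simp only: admissible_def if_True)
next
  case False
  \<comment> \<open>An odd s_n has to be squared. One level higher its letter is isolated, so the
    last level of run \<open>n\<close> is used, where the letter occurs twice in a row.\<close>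
  define k where "k = run_start a n + (a n - 1)"
  have k: "Suc k = run_start a (Suc n)" "run_letters a k = run_letter n"
    using pos run_letters_at[OF pos, of "a n - 1" n] by (simp_all add: k_def)
  obtain i where "U (Suc k) i = run_letters a k"
    using run_letter_occurs[of "Suc k" "Suc (Suc n)"] k by auto
  then obtain i where i: "U k i = run_letter n" "U k (Suc i) = run_letter n"
    using level_square k by metis
  have w: "level_weight (run_letters a) f k (run_letter n) = std_weight a f (Suc n)"
    "level_weight (run_letters a) f k (run_letter (Suc n)) =
       std_weight a f n + (a n - 1) * std_weight a f (Suc n)" for f
    using level_weight_run[OF pos, of "a n - 1" n f] by (simp_all add: k_def)
  obtain i' p' l' where *: "repeats (U 0) i' p' l'"
    "\<And>f. sum_list (map f (U 0 [i' \<rightarrow> i' + p'])) =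
       sum_list (map (level_weight (run_letters a) f k) (U k [i \<rightarrow> i + 2]))"
    "l' + 2 = level_weight (run_letters a) (\<lambda>_. 1) k 0 + level_weight (run_letters a) (\<lambda>_. 1) k 1"
    using descend[of k i 2] by blast
  have sum: "sum_list (map f (U 0 [i' \<rightarrow> i' + p'])) = 2 * std_weight a f (Suc n)" for f
    using *(2)[of f] i w by (simp add: numeral_2_eq_2)
  have p: "p' = 2 * std_length a (Suc n)"
    using sum[of "\<lambda>_. 1"] unfolding sum_list_subsequence by simp
  have "std_length a (Suc n) + (a n - 1) * std_length a (Suc n) = a n * std_length a (Suc n)"
    using pos by (metis mult_Suc Suc_diff_1)
  then have "l' + 2 = std_length a (Suc (Suc n))"
    using *(3) w run_letter_sum[of "level_weight (run_letters a) (\<lambda>_. 1) k" n] by simp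
  moreover have "2 * l' + 2 < 5 * p'"
    using bound[OF _ *(1)] sum p std_length_pos[OF pos, of "Suc n"] by simp
  moreover have "y \<le> 5 * x"
    if "2 * l' + 2 < 5 * p'" "l' + 2 = y" "p' = 2 * x" for x y
    using that by linarith
  ultimately have "std_length a (Suc (Suc n)) \<le> 5 * std_length a (Suc n)"
    using p by blast
  then show ?thesis using False by (simp only: admissible_def if_False)
qed

section \<open>A uniform bound from admissibility\<close>

context
  assumes adm: "\<And>n. admissible a n"
begin

lemma admissible_le_4: "a n \<le> 4"
proof (cases "even (std_ones a (Suc n))")
  case True
  then obtain m where "n = Suc m" by (cases n) auto
  then show ?thesis using True admissible_even[OF pos, of m] adm by simp
next
  case False
  then show ?thesis using admissible_odd[OF pos] adm by blast
qed

lemma std_length_le_5: "std_length a (Suc n) \<le> 5 * std_length a n"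
proof (cases n)
  case (Suc m)
  have "a m * std_length a (Suc m) \<le> 4 * std_length a (Suc m)"
    using admissible_le_4 by (intro mult_right_mono) auto
  then show ?thesis
    using std_length_mono[OF pos, of m] unfolding Suc std_weight.simps distrib_left by linarith
qed simp

text \<open>
  All exponents are at most 4, so the ratios \<open>\<bar>s\<^bsub>n-1\<^esub>\<bar> / \<bar>s\<^sub>n\<bar>\<close> stay away from their critical
  values and the supremum stays below \<open>7/2\<close>: it is at most \<open>38/11 = 3 + 5/11\<close>, by the next two gaps.
\<close>

lemma gap_odd: "6 * std_length a n \<le> 5 * std_length a (Suc n) + 6"
proof (cases n)
  case (Suc m)
  have "0 < a m" using pos by blast
  then have "1 * std_length a (Suc m) \<le> a m * std_length a (Suc m)"
    by (intro mult_right_mono) auto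
  then show ?thesis
    using std_length_le_5[of m] unfolding Suc std_weight.simps distrib_left by linarith
qed simp

lemma gap_even:
  assumes "even (std_ones a (Suc n))"
  shows "a n = 1" and "11 * std_length a n \<le> 5 * std_length a (Suc n) + 11"
proof -
  obtain m where n: "n = Suc m" using assms by (cases n) auto
  have *: "a (Suc m) = 1" "2 \<le> a m \<or> m = 1 \<and> a 0 = 1 \<and> a 1 = 1"
    using admissible_even[OF pos, of m] adm assms n by auto
  show "a n = 1" using * n by simp
  show "11 * std_length a n \<le> 5 * std_length a (Suc n) + 11"
    using *(2)
  proof
    assume "2 \<le> a m"
    then have "2 * std_length a (Suc m) \<le> a m * std_length a (Suc m)"
      by (intro mult_right_mono) auto
    then show ?thesis
      using std_length_le_5[of m] unfolding n std_weight.simps distrib_left by linarith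
  next
    \<comment> \<open>The lengths are 2 and 3 here, which is why the additive 11 is needed.\<close>
    assume "m = 1 \<and> a 0 = 1 \<and> a 1 = 1"
    then show ?thesis using n by simp
  qed
qed

text \<open>At a level with empty overlap, \<open>l + 2\<close> is at most the sum of the letter
  weights. A root containing both letters is at least that long; otherwise it is a power of the run
  letter or the other letter alone.\<close>

lemma bound_of_admissible:
  assumes rep: "repeats (U 0) i p l" and p: "0 < p"
    and ev: "even (sum_list (map (\<lambda>x. if x = 1 then 1 else 0 :: nat) (U 0 [i \<rightarrow> i + p])))"
  shows "11 * l + 11 \<le> 27 * p"
proof -
  have large: "p < level_weight (run_letters a) (\<lambda>_. 1) (run_start a (Suc p)) x" for x
  proof -
    have "level_weight (run_letters a) (\<lambda>_. 1) (run_start a (Suc p)) x \<in>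
        {std_length a (Suc p), std_length a (Suc (Suc p))}"
      using bit_run_letter_cases[of x "Suc p"] level_weight_run[OF pos, of 0 "Suc p" "\<lambda>_. 1"] by auto
    then show ?thesis
      using std_length_ge[OF pos, of "Suc p"] std_length_ge[OF pos, of "Suc (Suc p)"] by auto
  qed
  obtain p' k i' where p': "0 < p'"
    and sum: "\<And>f. sum_list (map f (U 0 [i \<rightarrow> i + p])) =
       sum_list (map (level_weight (run_letters a) f k) (U k [i' \<rightarrow> i' + p']))"
    and l: "l + 2 \<le> level_weight (run_letters a) (\<lambda>_. 1) k 0 + level_weight (run_letters a) (\<lambda>_. 1) k 1"
    by (rule ascend_fully[OF rep p large]) (rule that)
  obtain n j where k: "k = run_start a n + j" and j: "j < a n" by (rule run_cases[OF pos])
  define b where "b = run_letter n"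
  define b' where "b' = run_letter (Suc n)"
  define Q where "Q = std_length a"
  define P where "P = std_ones a"
  define g where "g = level_weight (run_letters a) (\<lambda>_. 1) k"
  define h where "h = level_weight (run_letters a) (\<lambda>x. if x = 1 then 1 else 0) k"
  have g: "g b = Q (Suc n)" "g b' = Q n + j * Q (Suc n)"
    and h: "h b = P (Suc n)" "h b' = P n + j * P (Suc n)"
    using level_weight_run[OF pos, of j n] j k
    by (simp_all add: g_def h_def Q_def P_def b_def b'_def)
  have l: "l + 2 \<le> g b + g b'"
    using l run_letter_sum[of g n] by (simp add: g_def b_def b'_def)
  have p_sum: "p = (\<Sum>m<p'. g (U k (i' + m)))"
    using sum[of "\<lambda>_. 1"] unfolding sum_list_subsequence g_def by simp
  have ev_sum: "even (\<Sum>m<p'. h (U k (i' + m)))"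
    using ev sum[of "\<lambda>x. if x = 1 then 1 else 0"] unfolding sum_list_subsequence h_def by simp
  have ck: "run_letters a k = b" using run_letters_at[OF pos j] k b_def by simp
  have Q: "0 < Q n" "Q n \<le> Q (Suc n)"
    using std_length_pos[OF pos] std_length_mono[OF pos] by (simp_all add: Q_def)
  consider (both) m1 m2 where "m1 < p'" "m2 < p'" "U k (i' + m1) = b" "U k (i' + m2) = b'"
    | (only_b) "\<And>m. m < p' \<Longrightarrow> U k (i' + m) = b"
    | (only_b') "\<And>m. m < p' \<Longrightarrow> U k (i' + m) = b'"
  proof (cases "(\<forall>m<p'. U k (i' + m) = b) \<or> (\<forall>m<p'. U k (i' + m) = b')")
    case False
    then obtain m1 m2 where "m1 < p'" "U k (i' + m1) \<noteq> b'" "m2 < p'" "U k (i' + m2) \<noteq> b"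
      by blast
    moreover have "U k m = b \<or> U k m = b'" for m
      unfolding b_def b'_def by (rule bit_run_letter_cases)
    ultimately show thesis using that(1) by blast
  qed (use that(2,3) in blast)
  then show ?thesis
  proof cases
    case both
    have "b' \<noteq> b" by (simp add: b_def b'_def)
    then have "m1 \<noteq> m2" using both by auto
    have "(\<Sum>m\<in>{m1, m2}. g (U k (i' + m))) \<le> p"
      unfolding p_sum using both by (intro sum_mono2) auto
    then have "g b + g b' \<le> p" using \<open>m1 \<noteq> m2\<close> both by simp
    then show ?thesis using l by linarith
  next
    case only_b
    have "(\<Sum>m<p'. f (U k (i' + m))) = p' * f b" for f :: "bit \<Rightarrow> nat"
      using sum.cong[of "{..<p'}" "{..<p'}" "\<lambda>m. f (U k (i' + m))" "\<lambda>_. f b"] only_b by simp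
    then have p_eq: "p = p' * Q (Suc n)" and "even (p' * P (Suc n))"
      using p_sum ev_sum unfolding g(1)[symmetric] h(1)[symmetric] by metis+
    then consider "even (P (Suc n))" | "odd (P (Suc n))" "even p'" by auto
    then show ?thesis
    proof cases
      case 1
      \<comment> \<open>Evenness forces \<open>a n = 1\<close>, so run \<open>n\<close> has only
        this level.\<close>
      then have "j = 0" using gap_even(1)[of n] j by (simp add: P_def)
      moreover have "1 * Q (Suc n) \<le> p" unfolding p_eq using p' by (intro mult_right_mono) auto
      ultimately show ?thesis using l g Q by simp
    next
      case 2
      then have "2 \<le> p'" using p' by presburger
      then have "2 * Q (Suc n) \<le> p" unfolding p_eq by (intro mult_right_mono) auto
      moreover have "j \<le> 3" using j admissible_le_4[of n] by simp
      then have "j * Q (Suc n) \<le> 3 * Q (Suc n)" by (intro mult_right_mono) auto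
      moreover have "6 * Q n \<le> 5 * Q (Suc n) + 6" using gap_odd[of n] by (simp add: Q_def)
      ultimately show ?thesis using l unfolding g by linarith
    qed
  next
    case only_b'
    have "p' = 1"
    proof (rule ccontr)
      assume "p' \<noteq> 1"
      then have "U k i' = b'" "U k (Suc i') = b'"
        using p' only_b'[of 0] only_b'[of 1] by simp_all
      moreover have "b' \<noteq> b" by (simp add: b_def b'_def)
      ultimately show False using level_isolated[of k i'] ck by simp
    qed
    then have "U k i' = b'" using only_b'[of 0] by simp
    then have p_eq: "p = Q n + j * Q (Suc n)" and ev_eq: "even (P n + j * P (Suc n))"
      using p_sum ev_sum \<open>p' = 1\<close> unfolding g(2)[symmetric] h(2)[symmetric] by simp_all
    show ?thesis
    proof (cases "j = 0")
      case False
      then have "1 * Q (Suc n) \<le> j * Q (Suc n)" by (intro mult_right_mono) auto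
      then show ?thesis using l Q p_eq unfolding g by linarith
    next
      case True
      then have p: "p = Q n" and "even (P n)" and l: "l + 2 \<le> Q (Suc n) + Q n"
        using p_eq ev_eq l g by simp_all
      show ?thesis
      proof (cases n)
        case 0
        then show ?thesis using p l by (simp add: Q_def)
      next
        case (Suc m)
        \<comment> \<open>The case that fixes the constant: \<open>l + 2 \<le> 2 * Q n + Q m\<close>
          and the gap give 27 = 22 + 5.\<close>
        then have "a m = 1" "11 * Q m \<le> 5 * Q (Suc m) + 11"
          using gap_even[of m] \<open>even (P n)\<close> by (simp_all add: P_def Q_def)
        moreover have "Q (Suc (Suc m)) = a m * Q (Suc m) + Q m" by (simp add: Q_def)
        ultimately show ?thesis using p l Suc by simp
      qed
    qed
  qed
qed

end

end

theorem theorem37: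
  fixes u v :: "bit word" and a :: "nat word"
  assumes "standard_sturmian u"
    and "\<forall>i. 0 < a i"
    and "directive_sequence u (alternating_runs a)"
    and "cs_rote v"
    and "sum_word v = u"
  shows "critical_exponent v < ereal (7 / 2) \<longleftrightarrow> block_concatenation a"
proof -
  obtain U where "tower U (run_letters a)" and U0: "U 0 = sum_word v"
    using directive_tower[OF assms(3) alternating_runs_eq[OF assms(2)]] assms(5) by blast
  then interpret runs_tower U a
    using assms(2) by (intro runs_tower.intro runs_tower_axioms.intro)
  show ?thesis
  proof
    assume less: "critical_exponent v < ereal (7 / 2)"
    have bound: "2 * l + 2 < 5 * p"
      if "0 < p" "repeats (U 0) i p l"
        "even (sum_list (map (\<lambda>x. if x = 1 then 1 else 0 :: nat) (U 0 [i \<rightarrow> i + p])))" for i p l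
    proof -
      have "ereal (real (p + l + 1) / real p) < ereal (7 / 2)"
        using that less unfolding U0 by (intro le_less_trans[OF critical_exponent_ge])
      then have "real (2 * l + 2) < real (5 * p)"
        using that(1) by (simp add: field_simps)
      then show ?thesis by (simp only: of_nat_less_iff)
    qed
    have "admissible a n" for n by (rule admissible_of_bound) (rule bound)
    then show "block_concatenation a" by (rule admissible_imp_block_concatenation[OF assms(2)])
  next
    assume "block_concatenation a"
    then have adm: "admissible a n" for n
      by (rule block_concatenation_imp_admissible[OF assms(2)])
    \<comment> \<open>\<open>38 / 11\<close> is \<open>1 + 27 / 11\<close>. A uniform bound is
      required, as a supremum of numbers below \<open>7 / 2\<close> may equal
      \<open>7 / 2\<close>.\<close>
    have "critical_exponent v \<le> ereal (38 / 11)"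
    proof (rule critical_exponent_le)
      fix i p l assume "0 < p" "repeats (sum_word v) i p l"
        "even (sum_list (map (\<lambda>x. if x = 1 then 1 else 0 :: nat) (sum_word v [i \<rightarrow> i + p])))"
      then have "11 * l + 11 \<le> 27 * p"
        using bound_of_admissible[OF adm] unfolding U0 by blast
      then have "real (11 * l + 11) \<le> real (27 * p)" by (simp only: of_nat_le_iff)
      then show "real (p + l + 1) \<le> 38 / 11 * real p" by simp
    qed simp
    also have "\<dots> < ereal (7 / 2)" by simp
    finally show "critical_exponent v < ereal (7 / 2)" .
  qed
qed

end
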